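(* Let $N$ be the Iwasawa manifold with its standard left-invariant metric and fix $\alpha>0$. The set of invariant mixed structures $(J,V)\in\mathcal{F}^+$ on $N$ of class $\mathcal{W}_{34}\cap\mathcal{V}_{5}$ (i.e. $J$ is of class $\mathcal{W}_{34}$ and the almost product structure defined by $V$ is of class $\mathcal{V}_5$) is diffeomorphic to the disjoint union $\mathbb{CP}^1\sqcup\mathbb{CP}^1\sqcup\mathbb{CP}^1$. Its image under $\mu_T$ consists of three line segments: the segment joining $(1+\alpha,1,1)$ to $(1,1+\alpha,1)$, the segment joining $(1+\alpha,-1,-1)$ to $(-1,1+\alpha,-1)$, and the segment joining $(1,-1-\alpha,-1)$ to $(-1-\alpha,1,-1)$.
   Context: The Iwasawa manifold. $G_H$ is the complex Heisenberg group of matrices $\begin{pmatrix}1&z^1&z^3\\0&1&z^2\\0&0&1\end{pmatrix}$, $z^k\in\mathbb{C}$; $\Gamma\subset G_H$ is the subgroup with entries in $\mathbb{Z}[i]$; $N=\Gamma\backslash G_H$. Left-invariant real 1-forms $e^1,\dots,e^6$ are defined by $e^1+ie^2=dz^1$, $e^3+ie^4=dz^2$, $e^5+ie^6=-dz^3+z^1dz^2$; they descend to $N$. The metric $g$ on $N$ is the one for which $e^1,\dots,e^6$ are orthonormal, and the orientation is $e^1\wedge\dots\wedge e^6$. All structures are invariant, i.e. have constant coefficients in this frame, so they are identified with structures on $\mathbb{R}^6$ with orthonormal basis $e^1,\dots,e^6$ (tangent and cotangent vectors are identified by $g$). Write $e^{ij}=e^i\wedge e^j$. OCS, OPS, MS.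 An OCS is an orthogonal $J$ with $J^2=-1$, with 2-form $\omega_J(X,Y)=g(JX,Y)$; $\mathcal{P}^+$ is the set of OCS's inducing the given orientation. $\mathcal{G}=\mathrm{Gr}_2(\mathbb{R}^6)$ is the set of oriented 2-planes $V$; each defines an orthogonal almost product structure (OPS) $TN=\mathcal{V}\oplus\mathcal{H}$ with $\mathcal{V}=V$ and $\mathcal{H}=V^\perp$. If $V$ is $J$-invariant, it is oriented consistently with $J$ if $(v,Jv)$ is a positive basis for $0\neq v\in V$. $\mathcal{F}^+$ is the set of mixed structures (MS's) $(J,V)$ with $J\in\mathcal{P}^+$ and $V\in\mathcal{G}$ a $J$-invariant 2-plane oriented consistently with $J$. For $\alpha>0$, $\mathcal{F}^+$ is identified with the $SO(6)$-orbit of $(1+\alpha)e^{12}+e^{34}+e^{56}$ in $\Lambda^2\mathbb{R}^6\cong\mathfrak{so}(6)^*$ by $(J,V)\mapsto\omega_J+\alpha\,v\wedge Jv$, $v\in V$ a unit vector. The map $\mu_T:\mathcal{F}^+\to\mathbb{R}^3$ sends a 2-form to its coefficients along $e^{12},e^{34},e^{56}$ (it is the moment map of the maximal torus of $SO(6)$ of rotations in the planes $\langle e^1,e^2\rangle,\langle e^3,e^4\rangle,\langle e^5,e^6\rangle$). Torsion classes. $J$ is of class $\mathcal{W}_{34}$ (the Gray–Hervella class $\mathcal{W}_3\oplus\mathcal{W}_4$) if it is integrable (its Nijenhuis tensor vanishes). For an OPS with Levi-Civita connection $\nabla$, the intrinsic torsion consists of the tensors $A(v,v',h)=g(\nabla_vv',h)$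 and $B(h,h',v)=g(\nabla_hh',v)$ ($v,v'$ sections of $\mathcal{V}$, $h,h'$ sections of $\mathcal{H}$). Their components are $\mathcal{V}_1=\Lambda^2\mathcal{V}\otimes\mathcal{H}$, $\mathcal{V}_2=S^2_0\mathcal{V}\otimes\mathcal{H}$, $\mathcal{V}_3=1_{\mathcal{V}}\otimes\mathcal{H}$ (skew, tracefree symmetric, and trace part of $A$ in $(v,v')$) and $\mathcal{V}_4=\Lambda^2\mathcal{H}\otimes\mathcal{V}$, $\mathcal{V}_5=S_0^2\mathcal{H}\otimes\mathcal{V}$, $\mathcal{V}_6=1_{\mathcal{H}}\otimes\mathcal{V}$ (skew, tracefree symmetric, and trace part of $B$ in $(h,h')$). An OPS is of class $\mathcal{V}_{ij\dots}$ if its intrinsic torsion lies in $\mathcal{V}_i\oplus\mathcal{V}_j\oplus\cdots$. *)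

theory Defs
  imports "HOL-Analysis.Analysis"
begin

section \<open>Smooth maps\<close>

text \<open>Intended for open \<open>S\<close>: all iterated directional derivatives exist and are continuous.\<close>

primrec Ck_on ::
  "nat \<Rightarrow> 'a::euclidean_space set \<Rightarrow> ('a \<Rightarrow> 'b::euclidean_space) \<Rightarrow> bool" where
  "Ck_on 0 S f \<longleftrightarrow> continuous_on S f"
| "Ck_on (Suc k) S f \<longleftrightarrow>
     (\<forall>x\<in>S. f differentiable (at x)) \<and> (\<forall>v. Ck_on k S (\<lambda>x. frechet_derivative f (at x) v))"

definition smooth_on :: "'a::euclidean_space set \<Rightarrow> ('a \<Rightarrow> 'b::euclidean_space) \<Rightarrow> bool" where
  "smooth_on S f \<longleftrightarrow> (\<forall>k. Ck_on k S f)"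

text \<open>
  A manifold \<open>X\<close> is given by a set \<open>P\<close> of parametrizations (inverse charts), each defined on a
  whole Euclidean space, whose images cover \<open>X\<close>. A set \<open>M\<close> is given as a subset of a Euclidean
  space by an inclusion \<open>\<iota>\<close>. A diffeomorphism \<open>X \<rightarrow> M\<close> is a bijection that is smooth in every
  parametrization and whose inverse is smooth: near each point of \<open>\<iota> ` M\<close>, the inverse, read in
  some chart of \<open>X\<close>, extends to a smooth map \<open>h\<close> on an open subset of the ambient space.
\<close>

definition diffeomorphism_onto_subset ::
  "('c::euclidean_space \<Rightarrow> 'x) set \<Rightarrow> 'x set \<Rightarrow> ('m \<Rightarrow> 'e::euclidean_space) \<Rightarrow> 'm set
     \<Rightarrow> ('x \<Rightarrow> 'm) \<Rightarrow> bool" where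
  "diffeomorphism_onto_subset P X \<iota> M f \<longleftrightarrow>
     bij_betw f X M \<and>
     (\<forall>\<phi>\<in>P. smooth_on UNIV (\<lambda>u. \<iota> (f (\<phi> u)))) \<and>
     (\<forall>m\<in>M. \<exists>U h. \<exists>\<phi>\<in>P. open U \<and> \<iota> m \<in> U \<and> smooth_on U h \<and>
        (\<forall>m'\<in>M. \<iota> m' \<in> U \<longrightarrow> m' = f (\<phi> (h (\<iota> m')))))"


section \<open>The complex projective line\<close>

definition complex_line :: "complex^2 \<Rightarrow> (complex^2) set" where
  "complex_line v = range (\<lambda>c. c *s v)"

definition CP1 :: "(complex^2) set set" where
  "CP1 = {complex_line v |v. v \<noteq> 0}"

text \<open>The inverses of the two affine charts.\<close>

definition CP1_params :: "(complex \<Rightarrow> (complex^2) set) set" where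
  "CP1_params = {\<lambda>z. complex_line (vector [1, z]), \<lambda>z. complex_line (vector [z, 1])}"

definition three_CP1 :: "(3 \<times> (complex^2) set) set" where
  "three_CP1 = UNIV \<times> CP1"

definition three_CP1_params :: "(complex \<Rightarrow> 3 \<times> (complex^2) set) set" where
  "three_CP1_params = {\<lambda>z. (i, \<phi> z) |i \<phi>. \<phi> \<in> CP1_params}"


section \<open>The Iwasawa manifold\<close>

text \<open>
  Points of the Heisenberg group are written in the global coordinates \<open>(z\<^sup>1, z\<^sup>2, z\<^sup>3)\<close>, and
  tangent vectors by their components in these coordinates.
\<close>

definition heis :: "complex^3 \<Rightarrow> complex^3^3" where
  "heis z = vector [vector [1, z$1, z$3], vector [0, 1, z$2], vector [0, 0, 1]]"

definition heis_coords :: "complex^3^3 \<Rightarrow> complex^3" where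
  "heis_coords M = vector [M$1$2, M$2$3, M$1$3]"

definition heis_lattice :: "(complex^3^3) set" where
  "heis_lattice = {M \<in> range heis. \<forall>i j. Re (M$i$j) \<in> \<int> \<and> Im (M$i$j) \<in> \<int>}"

definition left_translation :: "complex^3^3 \<Rightarrow> complex^3 \<Rightarrow> complex^3" where
  "left_translation M z = heis_coords (M ** heis z)"

text \<open>
  The projection of the Heisenberg group onto its quotient by the lattice is a covering, so smooth
  functions and smooth vector fields on the quotient are the same as smooth functions and vector
  fields on the group that are invariant under left translation by lattice elements.
\<close>

type_synonym vfield = "complex^3 \<Rightarrow> complex^3"

definition smooth_functions :: "(complex^3 \<Rightarrow> real) set" where
  "smooth_functions = {f. smooth_on UNIV f \<and>
     (\<forall>M\<in>heis_lattice. \<forall>p. f (left_translation M p) = f p)}"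

definition vector_fields :: "vfield set" where
  "vector_fields = {X. smooth_on UNIV X \<and>
     (\<forall>M\<in>heis_lattice. \<forall>p.
        X (left_translation M p) = frechet_derivative (left_translation M) (at p) (X p))}"

definition dir_deriv :: "vfield \<Rightarrow> (complex^3 \<Rightarrow> real) \<Rightarrow> complex^3 \<Rightarrow> real" where
  "dir_deriv X f p = frechet_derivative f (at p) (X p)"

definition lie_bracket :: "vfield \<Rightarrow> vfield \<Rightarrow> vfield" where
  "lie_bracket X Y p = frechet_derivative Y (at p) (X p) - frechet_derivative X (at p) (Y p)"

text \<open>
  The values on \<open>\<xi>\<close> of the left-invariant forms \<open>e\<^sup>1, \<dots>, e\<^sup>6\<close> at \<open>p\<close>, where
  \<open>e\<^sup>1 + i e\<^sup>2 = dz\<^sup>1\<close>, \<open>e\<^sup>3 + i e\<^sup>4 = dz\<^sup>2\<close>, \<open>e\<^sup>5 + i e\<^sup>6 = - dz\<^sup>3 + z\<^sup>1 dz\<^sup>2\<close>.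
\<close>

definition coframe :: "complex^3 \<Rightarrow> complex^3 \<Rightarrow> real^6" where
  "coframe p \<xi> = vector
     [Re (\<xi>$1), Im (\<xi>$1), Re (\<xi>$2), Im (\<xi>$2),
      Re (- \<xi>$3 + p$1 * \<xi>$2), Im (- \<xi>$3 + p$1 * \<xi>$2)]"

text \<open>The left-invariant vector field with components \<open>x\<close> in the frame dual to \<open>e\<^sup>1, \<dots>, e\<^sup>6\<close>.\<close>

definition inv_field :: "real^6 \<Rightarrow> vfield" where
  "inv_field x p = inv (coframe p) x"

definition metric :: "complex^3 \<Rightarrow> complex^3 \<Rightarrow> complex^3 \<Rightarrow> real" where
  "metric p \<xi> \<eta> = coframe p \<xi> \<bullet> coframe p \<eta>"

definition levi_civita :: "(vfield \<Rightarrow> vfield \<Rightarrow> vfield) \<Rightarrow> bool" where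
  "levi_civita D \<longleftrightarrow>
     (\<forall>X\<in>vector_fields. \<forall>Y\<in>vector_fields. D X Y \<in> vector_fields) \<and>
     (\<forall>X\<in>vector_fields. \<forall>Y\<in>vector_fields. \<forall>Z\<in>vector_fields. \<forall>p.
        D (\<lambda>q. X q + Y q) Z p = D X Z p + D Y Z p \<and>
        D X (\<lambda>q. Y q + Z q) p = D X Y p + D X Z p) \<and>
     (\<forall>f\<in>smooth_functions. \<forall>X\<in>vector_fields. \<forall>Y\<in>vector_fields. \<forall>p.
        D (\<lambda>q. f q *\<^sub>R X q) Y p = f p *\<^sub>R D X Y p \<and>
        D X (\<lambda>q. f q *\<^sub>R Y q) p = dir_deriv X f p *\<^sub>R Y p + f p *\<^sub>R D X Y p) \<and>
     (\<forall>X\<in>vector_fields. \<forall>Y\<in>vector_fields. \<forall>Z\<in>vector_fields. \<forall>p.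
        dir_deriv X (\<lambda>q. metric q (Y q) (Z q)) p
          = metric p (D X Y p) (Z p) + metric p (Y p) (D X Z p)) \<and>
     (\<forall>X\<in>vector_fields. \<forall>Y\<in>vector_fields. \<forall>p. D X Y p - D Y X p = lie_bracket X Y p)"

text \<open>Unique on \<open>vector_fields\<close>, which is all that matters below.\<close>

definition LC :: "vfield \<Rightarrow> vfield \<Rightarrow> vfield" where
  "LC = (SOME D. levi_civita D)"


section \<open>Invariant orthogonal complex structures\<close>

text \<open>
  Invariant tensors are identified with tensors on \<open>\<real>\<^sup>6\<close> by means of the frame. A matrix \<open>J\<close>
  acts on the column of components of a tangent vector.
\<close>

text \<open>The orientation induced by \<open>J\<close> is that of the bases \<open>(u, Ju, v, Jv, w, Jw)\<close>.\<close>

definition OCS_pos :: "(real^6^6) set" where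
  "OCS_pos = {J. orthogonal_matrix J \<and> J ** J = - mat 1 \<and>
     (\<exists>u v w. det (vector [u, J *v u, v, J *v v, w, J *v w] :: real^6^6) > 0)}"

definition act :: "real^6^6 \<Rightarrow> vfield \<Rightarrow> vfield" where
  "act J X p = inv_field (J *v coframe p (X p)) p"

definition nijenhuis :: "real^6^6 \<Rightarrow> vfield \<Rightarrow> vfield \<Rightarrow> vfield" where
  "nijenhuis J X Y p =
     lie_bracket (act J X) (act J Y) p
     - act J (lie_bracket (act J X) Y) p
     - act J (lie_bracket X (act J Y)) p
     - lie_bracket X Y p"

definition class_W34 :: "real^6^6 \<Rightarrow> bool" where
  "class_W34 J \<longleftrightarrow> (\<forall>X\<in>vector_fields. \<forall>Y\<in>vector_fields. \<forall>p. nijenhuis J X Y p = 0)"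


section \<open>Invariant orthogonal almost product structures\<close>

text \<open>
  An oriented 2-plane is a plane together with the set of its positive ordered bases.
\<close>

type_synonym oplane = "(real^6) set \<times> ((real^6) \<times> (real^6)) set"

definition positive_bases :: "real^6 \<Rightarrow> real^6 \<Rightarrow> ((real^6) \<times> (real^6)) set" where
  "positive_bases a b =
     {(a11 *\<^sub>R a + a12 *\<^sub>R b, a21 *\<^sub>R a + a22 *\<^sub>R b) |a11 a12 a21 a22.
        a11 * a22 - a12 * a21 > 0}"

definition oriented_planes :: "oplane set" where
  "oriented_planes =
     {(span {a, b}, positive_bases a b) |a b. a \<noteq> b \<and> independent {a, b}}"

text \<open>
  \<open>nabla_coeff p x y z\<close> is \<open>g(\<nabla>\<^sub>x y, z)\<close> at \<open>p\<close>, with \<open>x\<close>, \<open>y\<close>, \<open>z\<close> extended to invariant fields.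
  For \<open>V \<subseteq> \<real>\<^sup>6\<close> the extension of \<open>y \<in> V\<close> is a section of the corresponding distribution.
  As \<open>A(v,v',h)\<close> and \<open>B(h,h',v)\<close> are tensors, they are at \<open>p\<close> the restrictions of
  \<open>nabla_coeff p\<close> to \<open>V \<times> V \<times> V\<^sup>\<bottom>\<close> and \<open>V\<^sup>\<bottom> \<times> V\<^sup>\<bottom> \<times> V\<close>.
\<close>

type_synonym tensor3 = "real^6 \<Rightarrow> real^6 \<Rightarrow> real^6 \<Rightarrow> real"

definition nabla_coeff :: "complex^3 \<Rightarrow> tensor3" where
  "nabla_coeff p x y z = metric p (LC (inv_field x) (inv_field y) p) (inv_field z p)"

definition orthonormal_basis :: "(real^6) set \<Rightarrow> (real^6) set \<Rightarrow> bool" where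
  "orthonormal_basis U B \<longleftrightarrow>
     pairwise orthogonal B \<and> (\<forall>b\<in>B. norm b = 1) \<and> span B = U"

definition skew_part :: "tensor3 \<Rightarrow> tensor3" where
  "skew_part T x y z = (T x y z - T y x z) / 2"

definition trace_part :: "(real^6) set \<Rightarrow> tensor3 \<Rightarrow> tensor3" where
  "trace_part U T x y z =
     (x \<bullet> y) / real (dim U) * (\<Sum>b\<in>(SOME B. orthonormal_basis U B). T b b z)"

definition tracefree_sym_part :: "(real^6) set \<Rightarrow> tensor3 \<Rightarrow> tensor3" where
  "tracefree_sym_part U T x y z = (T x y z + T y x z) / 2 - trace_part U T x y z"

definition vanishes_on :: "(real^6) set \<Rightarrow> (real^6) set \<Rightarrow> tensor3 \<Rightarrow> bool" where
  "vanishes_on U U' T \<longleftrightarrow> (\<forall>x\<in>U. \<forall>y\<in>U. \<forall>z\<in>U'. T x y z = 0)"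

text \<open>Vanishing at \<open>p\<close> of the component of the intrinsic torsion in \<open>\<V>\<^sub>k\<close>, for \<open>k = 1, \<dots>, 6\<close>.\<close>

definition torsion_component_zero :: "nat \<Rightarrow> (real^6) set \<Rightarrow> complex^3 \<Rightarrow> bool" where
  "torsion_component_zero k V p \<longleftrightarrow>
     (k = 1 \<longrightarrow> vanishes_on V (V\<^sup>\<bottom>) (skew_part (nabla_coeff p))) \<and>
     (k = 2 \<longrightarrow> vanishes_on V (V\<^sup>\<bottom>) (tracefree_sym_part V (nabla_coeff p))) \<and>
     (k = 3 \<longrightarrow> vanishes_on V (V\<^sup>\<bottom>) (trace_part V (nabla_coeff p))) \<and>
     (k = 4 \<longrightarrow> vanishes_on (V\<^sup>\<bottom>) V (skew_part (nabla_coeff p))) \<and>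
     (k = 5 \<longrightarrow> vanishes_on (V\<^sup>\<bottom>) V (tracefree_sym_part (V\<^sup>\<bottom>) (nabla_coeff p))) \<and>
     (k = 6 \<longrightarrow> vanishes_on (V\<^sup>\<bottom>) V (trace_part (V\<^sup>\<bottom>) (nabla_coeff p)))"

definition OPS_class :: "nat set \<Rightarrow> oplane \<Rightarrow> bool" where
  "OPS_class S V \<longleftrightarrow> (\<forall>p. \<forall>k\<in>{1..6} - S. torsion_component_zero k (fst V) p)"


section \<open>Invariant mixed structures\<close>

type_synonym mixed = "(real^6^6) \<times> oplane"

definition mixed_structures :: "mixed set" where
  "mixed_structures = {(J, W, Or). J \<in> OCS_pos \<and> (W, Or) \<in> oriented_planes \<and>
     (\<forall>v\<in>W. J *v v \<in> W) \<and> (\<forall>v\<in>W. v \<noteq> 0 \<longrightarrow> (v, J *v v) \<in> Or)}"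

text \<open>
  A 2-form \<open>\<omega>\<close> on \<open>\<real>\<^sup>6\<close> is represented by the skew matrix of its values on pairs of basis
  vectors, so that \<open>\<omega>$i$j\<close> with \<open>i\<close> before \<open>j\<close> is the coefficient of \<open>e\<^sup>i \<and> e\<^sup>j\<close>.
\<close>

definition fundamental_form :: "real^6^6 \<Rightarrow> real^6^6" where
  "fundamental_form J = (\<chi> i j. (J *v axis i 1) \<bullet> axis j 1)"

definition wedge :: "real^6 \<Rightarrow> real^6 \<Rightarrow> real^6^6" where
  "wedge u v = (\<chi> i j. u$i * v$j - u$j * v$i)"

text \<open>
  For \<open>\<alpha> > 0\<close> the map \<open>mixed_form \<alpha>\<close> identifies \<open>mixed_structures\<close> with the orbit of
  \<open>(1 + \<alpha>) e\<^sup>1\<^sup>2 + e\<^sup>3\<^sup>4 + e\<^sup>5\<^sup>6\<close> under \<open>SO(6)\<close>, a compact submanifold of the space of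
  matrices; it is this identification that gives \<open>mixed_structures\<close> its smooth structure.
\<close>

definition mixed_form :: "real \<Rightarrow> mixed \<Rightarrow> real^6^6" where
  "mixed_form \<alpha> = (\<lambda>(J, W, Or). let v = (SOME v. v \<in> W \<and> norm v = 1)
     in fundamental_form J + \<alpha> *\<^sub>R wedge v (J *v v))"

definition moment_map :: "real^6^6 \<Rightarrow> real^3" where
  "moment_map \<omega> = vector [\<omega>$1$2, \<omega>$3$4, \<omega>$5$6]"

definition mixed_W34_V5 :: "mixed set" where
  "mixed_W34_V5 = {(J, V) \<in> mixed_structures. class_W34 J \<and> OPS_class {5} V}"

end

theory Submission
  imports Defs
begin

text \<open>
  The Lie algebra of \<open>G\<^sub>H\<close> is \<open>\<complex>\<^sup>2 \<oplus> \<complex>\<close> with complex bilinear bracket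
  \<open>[x, y] = - (x\<^sub>1 y\<^sub>2 - x\<^sub>2 y\<^sub>1)\<close> taking values in the central summand \<open>\<langle>e\<^sub>5, e\<^sub>6\<rangle>\<close>. Write
  \<open>J0\<close> for the standard complex structure, so that \<open>[J0 x, y] = J0 [x, y]\<close>. Once connection and
  Nijenhuis tensor are expressed through this bracket (lemmas \<open>nabla_coeff_eq\<close> and
  \<open>class_W34_iff\<close>), everything is linear algebra in \<open>\<real>\<^sup>6 = \<complex>\<^sup>3\<close>.
\<close>

text \<open>
  Class \<open>\<V>\<^sub>5\<close> says that \<open>V\<close> is totally geodesic and that its complement \<open>H\<close> is integrable and
  minimal. A totally geodesic \<open>V\<close> is closed under the bracket, hence abelian, because a nonzero
  bracket would be a central vector of \<open>V\<close>. Moreover \<open>g([z, x], x) = 0\<close> for \<open>x \<in> V\<close> and every \<open>z\<close>,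
  which makes each \<open>x \<in> V\<close> either horizontal (in \<open>\<complex>\<^sup>2\<close>) or vertical. A nonzero vertical
  vector would make all of \<open>V\<close> vertical, so that \<open>H\<close> would be \<open>\<complex>\<^sup>2\<close>, which is not integrable.
  So \<open>V\<close> is an abelian plane in \<open>\<complex>\<^sup>2\<close>, and two vectors of \<open>\<complex>\<^sup>2\<close> commute exactly if they are
  \<open>\<complex>\<close>-dependent: \<open>V\<close> is a complex line. Conversely every complex line in \<open>\<complex>\<^sup>2\<close> is of class
  \<open>\<V>\<^sub>5\<close> (lemma \<open>OPS_class_hline\<close>).
\<close>

text \<open>
  Let \<open>J\<close> be an integrable orthogonal structure preserving such a line \<open>L\<close>. On \<open>L\<close> it is
  \<open>\<plusminus> J0\<close>, and the Nijenhuis tensor on \<open>L\<close> and \<open>e\<^sub>5\<close> forces \<open>J\<close> to preserve \<open>\<langle>e\<^sub>5, e\<^sub>6\<rangle>\<close>.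
  Hence \<open>J\<close> equals \<open>\<epsilon>\<^sub>1 J0\<close>, \<open>\<epsilon>\<^sub>2 J0\<close>, \<open>\<epsilon>\<^sub>3 J0\<close> on \<open>L\<close>, on \<open>L\<^sup>\<bottom> \<inter> \<complex>\<^sup>2\<close> and on \<open>\<langle>e\<^sub>5, e\<^sub>6\<rangle>\<close>
  (lemma \<open>integrable_eq_split_J\<close>). Integrability is then \<open>\<epsilon>\<^sub>3 (\<epsilon>\<^sub>1 + \<epsilon>\<^sub>2) = \<epsilon>\<^sub>1 \<epsilon>\<^sub>2 + 1\<close> and positivity is
  \<open>\<epsilon>\<^sub>1 \<epsilon>\<^sub>2 \<epsilon>\<^sub>3 = 1\<close>, which leaves \<open>(1, 1, 1)\<close>, \<open>(1, -1, -1)\<close> and \<open>(-1, 1, -1)\<close>. For each of these the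
  line is arbitrary, so there are three copies of \<open>\<complex>\<P>\<^sup>1\<close> (lemma \<open>mixed_W34_V5_standard\<close>).
\<close>

text \<open>
  The 2-form of the structure given by \<open>\<epsilon>\<close> and \<open>L = \<complex>v\<close> is
  \<open>\<epsilon>\<^sub>2 (e\<^sup>1\<^sup>2 + e\<^sup>3\<^sup>4) + \<epsilon>\<^sub>3 e\<^sup>5\<^sup>6 + \<kappa> (v \<and> J0 v) / |v|\<^sup>2\<close> with \<open>\<kappa> = (1 + \<alpha>) \<epsilon>\<^sub>1 - \<epsilon>\<^sub>2 \<noteq> 0\<close>
  (lemma \<open>mixed_form_standard\<close>). It is smooth in the affine coordinate of the line, and that
  coordinate is a quotient of entries of the form, so the parametrization is a diffeomorphism. The
  diagonal entries \<open>|v\<^sub>1|\<^sup>2 / |v|\<^sup>2\<close> and \<open>|v\<^sub>2|\<^sup>2 / |v|\<^sup>2\<close> are arbitrary nonnegative numbers with sum 1,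
  which gives the segments.
\<close>

section \<open>Closure properties of smooth maps\<close>

lemma Ck_on_Suc_imp: "Ck_on (Suc k) S f \<Longrightarrow> Ck_on k S f"
proof (induction k arbitrary: f)
  case 0
  then show ?case
    by (auto intro!: differentiable_imp_continuous_on differentiable_at_imp_differentiable_on)
next
  case (Suc k)
  then show ?case by (metis Ck_on.simps(2))
qed

lemma Ck_on_cong:
  assumes "open S" "\<And>x. x \<in> S \<Longrightarrow> f x = g x" "Ck_on k S f"
  shows "Ck_on k S g"
  using assms(2,3)
proof (induction k arbitrary: f g)
  case 0
  then show ?case using continuous_on_cong by force
next
  case (Suc k)
  have der: "(g has_derivative frechet_derivative f (at x)) (at x)" if "x \<in> S" for x
  proof (rule has_derivative_transform_within_open[OF _ assms(1) that])
    show "(f has_derivative frechet_derivative f (at x)) (at x)"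
      using Suc.prems that by (simp add: frechet_derivative_works)
  qed (use Suc.prems in auto)
  have eq: "frechet_derivative f (at x) v = frechet_derivative g (at x) v" if "x \<in> S" for x v
    using frechet_derivative_at[OF der[OF that]] by simp
  show ?case
    using Suc.IH[OF eq] Suc.prems(2) der by (auto simp: differentiable_def)
qed

text \<open>
  Lets a derivative in closed form stand in for the \<open>frechet_derivative\<close> of the definition, so that
  each closure property below is the corresponding differentiation rule plus an induction on the
  order.
\<close>

lemma Ck_on_SucI:
  assumes "open S" "\<And>x. x \<in> S \<Longrightarrow> (f has_derivative F x) (at x)" "\<And>v. Ck_on k S (\<lambda>x. F x v)"
  shows "Ck_on (Suc k) S f"
proof -
  have "Ck_on k S (\<lambda>x. frechet_derivative f (at x) v)" for v
    using assms(3)[of v] by (rule Ck_on_cong[OF assms(1), rotated])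
      (metis assms(2) frechet_derivative_at)
  then show ?thesis using assms(2) by (auto simp: differentiable_def)
qed

lemma Ck_on_Suc_derivative:
  assumes "Ck_on (Suc k) S f" "x \<in> S"
  shows "(f has_derivative frechet_derivative f (at x)) (at x)"
  using assms by (simp add: frechet_derivative_works)

lemma Ck_on_const: "open S \<Longrightarrow> Ck_on k S (\<lambda>x. c)"
proof (induction k arbitrary: c)
  case (Suc k)
  then show ?case by (intro Ck_on_SucI[where F = "\<lambda>_ _. 0"]) auto
qed auto

lemma Ck_on_ident: "open S \<Longrightarrow> Ck_on k S (\<lambda>x. x)"
proof (cases k)
  case (Suc k)
  assume "open S"
  then show ?thesis unfolding Suc
    by (intro Ck_on_SucI[where F = "\<lambda>_ v. v"]) (auto intro: Ck_on_const)
qed (auto intro: continuous_intros)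

lemma Ck_on_linear:
  assumes "bounded_linear L" "open S" "Ck_on k S f"
  shows "Ck_on k S (\<lambda>x. L (f x))"
  using assms(3)
proof (induction k arbitrary: f)
  case 0
  then show ?case using assms(1) by (auto intro: bounded_linear.continuous_on)
next
  case (Suc k)
  show ?case
  proof (rule Ck_on_SucI[OF assms(2)])
    show "((\<lambda>x. L (f x)) has_derivative (\<lambda>v. L (frechet_derivative f (at x) v))) (at x)"
      if "x \<in> S" for x
      by (rule bounded_linear.has_derivative[OF assms(1) Ck_on_Suc_derivative[OF Suc.prems that]])
    show "Ck_on k S (\<lambda>x. L (frechet_derivative f (at x) v))" for v
      using Suc by simp
  qed
qed

lemma Ck_on_add:
  assumes "open S" "Ck_on k S f" "Ck_on k S g"
  shows "Ck_on k S (\<lambda>x. f x + g x)"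
  using assms(2,3)
proof (induction k arbitrary: f g)
  case 0
  then show ?case by (auto intro: continuous_intros)
next
  case (Suc k)
  show ?case
  proof (rule Ck_on_SucI[OF assms(1)])
    show "((\<lambda>x. f x + g x) has_derivative
        (\<lambda>v. frechet_derivative f (at x) v + frechet_derivative g (at x) v)) (at x)"
      if "x \<in> S" for x
      by (rule has_derivative_add[OF Ck_on_Suc_derivative[OF Suc.prems(1) that]
            Ck_on_Suc_derivative[OF Suc.prems(2) that]])
    show "Ck_on k S (\<lambda>x. frechet_derivative f (at x) v + frechet_derivative g (at x) v)" for v
      using Suc by simp
  qed
qed

text \<open>
  The product rule leaves one factor undifferentiated; the induction therefore also needs the
  factors at the lower order, which is \<open>Ck_on_Suc_imp\<close>.
\<close>

lemma Ck_on_bilinear: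
  assumes "bounded_bilinear B" "open S" "Ck_on k S f" "Ck_on k S g"
  shows "Ck_on k S (\<lambda>x. B (f x) (g x))"
  using assms(3,4)
proof (induction k arbitrary: f g)
  case 0
  then show ?case using assms(1) by (auto intro: bounded_bilinear.continuous_on)
next
  case (Suc k)
  show ?case
  proof (rule Ck_on_SucI[OF assms(2)])
    show "((\<lambda>x. B (f x) (g x)) has_derivative
        (\<lambda>v. B (f x) (frechet_derivative g (at x) v) + B (frechet_derivative f (at x) v) (g x))) (at x)"
      if "x \<in> S" for x
      by (rule bounded_bilinear.FDERIV[OF assms(1) Ck_on_Suc_derivative[OF Suc.prems(1) that]
            Ck_on_Suc_derivative[OF Suc.prems(2) that]])
    have "Ck_on k S f" "Ck_on k S g"
      using Suc.prems Ck_on_Suc_imp by blast+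
    then show "Ck_on k S (\<lambda>x. B (f x) (frechet_derivative g (at x) v)
        + B (frechet_derivative f (at x) v) (g x))" for v
      using Suc by (auto intro!: Ck_on_add assms)
  qed
qed

lemma Ck_on_inverse:
  fixes f :: "'a::euclidean_space \<Rightarrow> real"
  assumes "open S" "\<And>x. x \<in> S \<Longrightarrow> f x \<noteq> 0" "Ck_on k S f"
  shows "Ck_on k S (\<lambda>x. inverse (f x))"
  using assms(3)
proof (induction k)
  case 0
  then show ?case using assms by (auto intro!: continuous_intros)
next
  case (Suc k)
  show ?case
  proof (rule Ck_on_SucI[OF assms(1)])
    show "((\<lambda>x. inverse (f x)) has_derivative
        (\<lambda>v. (inverse (f x) * inverse (f x)) * - frechet_derivative f (at x) v)) (at x)"
      if "x \<in> S" for x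
      by (rule has_derivative_eq_rhs,
          rule Deriv.has_derivative_inverse[OF assms(2)[OF that] Ck_on_Suc_derivative[OF Suc.prems that]])
        (simp add: fun_eq_iff)
    have inv: "Ck_on k S (\<lambda>x. inverse (f x))"
      using Suc.IH Ck_on_Suc_imp[OF Suc.prems] .
    have neg: "Ck_on k S (\<lambda>x. - frechet_derivative f (at x) v)" for v
      by (rule Ck_on_linear[OF bounded_linear_minus[OF bounded_linear_ident] assms(1)])
        (use Suc.prems in auto)
    show "Ck_on k S (\<lambda>x. (inverse (f x) * inverse (f x)) * - frechet_derivative f (at x) v)" for v
      by (intro Ck_on_bilinear[OF bounded_bilinear_mult assms(1)] inv neg)
  qed
qed

lemma smooth_on_const: "open S \<Longrightarrow> smooth_on S (\<lambda>x. c)"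
  by (simp add: smooth_on_def Ck_on_const)

lemma smooth_on_ident: "open S \<Longrightarrow> smooth_on S (\<lambda>x. x)"
  by (simp add: smooth_on_def Ck_on_ident)

lemma smooth_on_linear:
  "bounded_linear L \<Longrightarrow> open S \<Longrightarrow> smooth_on S f \<Longrightarrow> smooth_on S (\<lambda>x. L (f x))"
  by (simp add: smooth_on_def Ck_on_linear)

lemma smooth_on_add:
  "open S \<Longrightarrow> smooth_on S f \<Longrightarrow> smooth_on S g \<Longrightarrow> smooth_on S (\<lambda>x. f x + g x)"
  by (simp add: smooth_on_def Ck_on_add)

lemma smooth_on_bilinear:
  "bounded_bilinear B \<Longrightarrow> open S \<Longrightarrow> smooth_on S f \<Longrightarrow> smooth_on S g \<Longrightarrow>
     smooth_on S (\<lambda>x. B (f x) (g x))"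
  by (simp add: smooth_on_def Ck_on_bilinear)

lemma smooth_on_inverse:
  fixes f :: "'a::euclidean_space \<Rightarrow> real"
  shows "open S \<Longrightarrow> (\<And>x. x \<in> S \<Longrightarrow> f x \<noteq> 0) \<Longrightarrow> smooth_on S f \<Longrightarrow> smooth_on S (\<lambda>x. inverse (f x))"
  by (simp add: smooth_on_def Ck_on_inverse)

lemma smooth_on_sum:
  "open S \<Longrightarrow> (\<And>i. i \<in> I \<Longrightarrow> smooth_on S (f i)) \<Longrightarrow> smooth_on S (\<lambda>x. \<Sum>i\<in>I. f i x)"
proof (induction I rule: infinite_finite_induct)
  case (insert i I)
  then have "smooth_on S (\<lambda>x. f i x + (\<Sum>j\<in>I. f j x))"
    by (intro smooth_on_add) auto
  with insert.hyps show ?case by simp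
qed (simp_all add: smooth_on_const)

lemma smooth_on_has_derivative:
  assumes "smooth_on S f" "x \<in> S"
  shows "(f has_derivative frechet_derivative f (at x)) (at x)"
  using assms Ck_on_Suc_derivative unfolding smooth_on_def by blast

lemma smooth_on_frechet_derivative:
  assumes "smooth_on S f"
  shows "smooth_on S (\<lambda>x. frechet_derivative f (at x) v)"
  using assms unfolding smooth_on_def by (metis Ck_on.simps(2))

text \<open>
  The direction moves with the point, so it is expanded in a basis: this turns the derivative
  into a sum of products of smooth functions with derivatives in fixed directions.
\<close>

lemma smooth_on_derivative_along:
  fixes f :: "'a::euclidean_space \<Rightarrow> 'b::euclidean_space"
  assumes "open S" "smooth_on S f" "smooth_on S X"
  shows "smooth_on S (\<lambda>x. frechet_derivative f (at x) (X x))"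
proof -
  have "smooth_on S (\<lambda>x. \<Sum>b\<in>Basis. (X x \<bullet> b) *\<^sub>R frechet_derivative f (at x) b)"
    by (intro smooth_on_sum smooth_on_bilinear[OF bounded_bilinear_scaleR]
        smooth_on_frechet_derivative smooth_on_linear[OF bounded_linear_inner_left] assms)
  moreover have "(\<Sum>b\<in>Basis. (X x \<bullet> b) *\<^sub>R frechet_derivative f (at x) b)
      = frechet_derivative f (at x) (X x)" if "x \<in> S" for x
  proof -
    interpret bounded_linear "frechet_derivative f (at x)"
      using smooth_on_has_derivative[OF assms(2) that] by (rule has_derivative_bounded_linear)
    have "frechet_derivative f (at x) (X x)
        = frechet_derivative f (at x) (\<Sum>b\<in>Basis. (X x \<bullet> b) *\<^sub>R b)"
      by (simp only: euclidean_representation)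
    then show ?thesis by (simp add: sum scaleR)
  qed
  ultimately show ?thesis
    using Ck_on_cong[OF assms(1)] unfolding smooth_on_def by (metis (no_types, lifting))
qed

section \<open>Complex coordinates and the Lie bracket on invariant vectors\<close>

lemma exhaust_6:
  fixes x :: 6
  shows "x = 1 \<or> x = 2 \<or> x = 3 \<or> x = 4 \<or> x = 5 \<or> x = 6"
proof (induct x)
  case (of_int z)
  then have "z = 0 \<or> z = 1 \<or> z = 2 \<or> z = 3 \<or> z = 4 \<or> z = 5" by fastforce
  then show ?case by auto
qed

lemma forall_6: "(\<forall>i::6. P i) \<longleftrightarrow> P 1 \<and> P 2 \<and> P 3 \<and> P 4 \<and> P 5 \<and> P 6"
  by (metis exhaust_6)

lemma UNIV_6: "UNIV = {1, 2, 3, 4, 5, 6::6}"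
  using exhaust_6 by auto

lemma sum_6: "sum f (UNIV::6 set) = f 1 + f 2 + f 3 + f 4 + f 5 + f 6"
  unfolding UNIV_6 by (simp add: ac_simps)

lemma vector_6 [simp]:
  "(vector [a, b, c, d, e, f] :: 'a::zero^6) $ 1 = a"
  "(vector [a, b, c, d, e, f] :: 'a^6) $ 2 = b"
  "(vector [a, b, c, d, e, f] :: 'a^6) $ 3 = c"
  "(vector [a, b, c, d, e, f] :: 'a^6) $ 4 = d"
  "(vector [a, b, c, d, e, f] :: 'a^6) $ 5 = e"
  "(vector [a, b, c, d, e, f] :: 'a^6) $ 6 = f"
  unfolding vector_def by simp_all

text \<open>
  Components in the frame are combined into the values of the complex forms \<open>e\<^sup>1 + i e\<^sup>2\<close>,
  \<open>e\<^sup>3 + i e\<^sup>4\<close>, \<open>e\<^sup>5 + i e\<^sup>6\<close>, in which the bracket is complex bilinear.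
\<close>

definition cvec :: "complex \<Rightarrow> complex \<Rightarrow> complex \<Rightarrow> real^6" where
  "cvec a b c = vector [Re a, Im a, Re b, Im b, Re c, Im c]"

definition z1 :: "real^6 \<Rightarrow> complex" where "z1 x = Complex (x$1) (x$2)"
definition z2 :: "real^6 \<Rightarrow> complex" where "z2 x = Complex (x$3) (x$4)"
definition z3 :: "real^6 \<Rightarrow> complex" where "z3 x = Complex (x$5) (x$6)"

lemma z_cvec [simp]: "z1 (cvec a b c) = a" "z2 (cvec a b c) = b" "z3 (cvec a b c) = c"
  by (simp_all add: z1_def z2_def z3_def cvec_def)

lemma cvec_z [simp]: "cvec (z1 x) (z2 x) (z3 x) = x"
  by (simp add: z1_def z2_def z3_def cvec_def vec_eq_iff forall_6)

lemma z_eqI: "z1 x = z1 y \<Longrightarrow> z2 x = z2 y \<Longrightarrow> z3 x = z3 y \<Longrightarrow> x = y"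
  by (metis cvec_z)

lemma z_linear [simp]:
  "z1 0 = 0" "z2 0 = 0" "z3 0 = 0"
  "z1 (x + y) = z1 x + z1 y" "z2 (x + y) = z2 x + z2 y" "z3 (x + y) = z3 x + z3 y"
  "z1 (x - y) = z1 x - z1 y" "z2 (x - y) = z2 x - z2 y" "z3 (x - y) = z3 x - z3 y"
  "z1 (- x) = - z1 x" "z2 (- x) = - z2 x" "z3 (- x) = - z3 x"
  "z1 (r *\<^sub>R x) = of_real r * z1 x" "z2 (r *\<^sub>R x) = of_real r * z2 x" "z3 (r *\<^sub>R x) = of_real r * z3 x"
  by (simp_all add: z1_def z2_def z3_def complex_eq_iff)

lemma inner_z: "x \<bullet> y = Re (z1 x * cnj (z1 y) + z2 x * cnj (z2 y) + z3 x * cnj (z3 y))"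
  by (simp add: z1_def z2_def z3_def inner_vec_def sum_6)

lemma z_eq_iff: "x = y \<longleftrightarrow> z1 x = z1 y \<and> z2 x = z2 y \<and> z3 x = z3 y"
  using z_eqI by auto

text \<open>
  The bi-invariant complex structure of the complex Lie group, for which the three complex forms
  above are of type \<open>(1, 0)\<close>.
\<close>

definition J0 :: "real^6 \<Rightarrow> real^6" where
  "J0 x = cvec (\<i> * z1 x) (\<i> * z2 x) (\<i> * z3 x)"

text \<open>
  The Lie bracket of invariant fields. It is read off from \<open>d(e\<^sup>5 + i e\<^sup>6) = dz\<^sup>1 \<and> dz\<^sup>2\<close>,
  with the sign of \<open>d\<theta>(x, y) = - \<theta>([x, y])\<close>.
\<close>

definition bracket :: "real^6 \<Rightarrow> real^6 \<Rightarrow> real^6" where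
  "bracket x y = cvec 0 0 (z2 x * z1 y - z1 x * z2 y)"

text \<open>
  The covariant derivative of invariant fields: the solution of the Koszul formula
  \<open>2 g(\<nabla>\<^sub>x y, z) = g([x, y], z) - g([y, z], x) + g([z, x], y)\<close> for the vector \<open>\<nabla>\<^sub>x y\<close>.
\<close>

definition christoffel :: "real^6 \<Rightarrow> real^6 \<Rightarrow> real^6" where
  "christoffel x y = cvec ((- cnj (z2 y) * z3 x - cnj (z2 x) * z3 y) / 2)
     ((cnj (z1 y) * z3 x + cnj (z1 x) * z3 y) / 2) ((z2 x * z1 y - z1 x * z2 y) / 2)"

lemma z_ops [simp]:
  "z1 (J0 x) = \<i> * z1 x" "z2 (J0 x) = \<i> * z2 x" "z3 (J0 x) = \<i> * z3 x"
  "z1 (bracket x y) = 0" "z2 (bracket x y) = 0" "z3 (bracket x y) = z2 x * z1 y - z1 x * z2 y"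
  by (simp_all add: J0_def bracket_def)

lemma christoffel_torsion_free: "christoffel x y - christoffel y x = bracket x y"
  by (rule z_eqI) (simp_all add: christoffel_def field_simps)

lemma christoffel_metric: "christoffel x y \<bullet> z + y \<bullet> christoffel x z = 0"
  by (simp add: christoffel_def inner_z field_simps)

lemma bounded_bilinear_christoffel: "bounded_bilinear christoffel"
  unfolding bilinear_conv_bounded_bilinear[symmetric] bilinear_def
  by (auto intro!: linearI simp: christoffel_def z_eq_iff field_simps)

definition koszul_form :: tensor3 where
  "koszul_form x y z = (bracket x y \<bullet> z - bracket y z \<bullet> x + bracket z x \<bullet> y) / 2"

text \<open>
  The usual uniqueness argument: three cyclic copies of the metric condition, combined with
  torsion-freeness.
\<close>

lemma koszul:
  fixes G :: "real^6 \<Rightarrow> real^6 \<Rightarrow> real^6"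
  assumes "\<And>x y. G x y - G y x = bracket x y" "\<And>x y z. G x y \<bullet> z + y \<bullet> G x z = 0"
  shows "G x y \<bullet> z = koszul_form x y z"
proof -
  have t: "bracket x y \<bullet> z = G x y \<bullet> z - G y x \<bullet> z" for x y z
    by (simp add: assms(1)[symmetric] inner_diff_left)
  have m: "G x y \<bullet> z = - (G x z \<bullet> y)" for x y z
    using assms(2)[of x y z] by (simp add: inner_commute)
  show ?thesis
    unfolding koszul_form_def t using m[of x y z] m[of y x z] m[of z x y] by simp
qed

section \<open>The orientation of a complex basis\<close>

lemma J0_nth [simp]: "J0 x $ 1 = - x$2" "J0 x $ 2 = x$1" "J0 x $ 3 = - x$4" "J0 x $ 4 = x$3"
  "J0 x $ 5 = - x$6" "J0 x $ 6 = x$5"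
  by (simp_all add: J0_def cvec_def z1_def z2_def z3_def)

text \<open>
  The matrix whose determinant decides the orientation of the real basis of a complex one.
\<close>

abbreviation complex_frame :: "real^6 \<Rightarrow> real^6 \<Rightarrow> real^6 \<Rightarrow> real^6^6" where
  "complex_frame u v w \<equiv> vector [u, J0 u, v, J0 v, w, J0 w]"

text \<open>
  Cyclically exchanging three pairs of rows is an even permutation. The same computation with
  an explicit left factor of determinant 1 serves for complex row operations in the next lemma.
\<close>

lemma det_complex_frame_rotate: "det (complex_frame v w u) = det (complex_frame u v w)"
proof -
  define E :: "real^6^6" where "E = vector [axis 3 1, axis 4 1, axis 5 1, axis 6 1, axis 1 1, axis 2 1]"
  have "complex_frame v w u = E ** complex_frame u v w"
    by (simp add: vec_eq_iff forall_6 matrix_matrix_mult_def sum_6 E_def axis_def)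
  moreover have "det E = 1"
    unfolding E_def axis_def det_def UNIV_6
    by (simp add: sum_over_permutations_insert permutes_sing sign_swap_id permutation_swap_id
      sign_compose permutation_compose swap_id_eq)
  ultimately show ?thesis by (simp add: det_mul)
qed

text \<open>
  Adding the complex multiple \<open>(p + i q) u\<close> to \<open>v\<close> changes the rows of both \<open>v\<close> and \<open>J0 v\<close>; the
  left factor is the real form of a unipotent lower triangular complex matrix.
\<close>

lemma det_complex_frame_eliminate:
  "det (complex_frame u (v + p *\<^sub>R u + q *\<^sub>R J0 u) (w + r *\<^sub>R u + s *\<^sub>R J0 u)) = det (complex_frame u v w)"
proof -
  define E :: "real^6^6" where "E = vector [axis 1 1, axis 2 1,
     vector [p, q, 1, 0, 0, 0], vector [- q, p, 0, 1, 0, 0],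
     vector [r, s, 0, 0, 1, 0], vector [- s, r, 0, 0, 0, 1]]"
  have "complex_frame u (v + p *\<^sub>R u + q *\<^sub>R J0 u) (w + r *\<^sub>R u + s *\<^sub>R J0 u) = E ** complex_frame u v w"
    by (simp add: vec_eq_iff forall_6 matrix_matrix_mult_def sum_6 E_def axis_def algebra_simps)
  moreover have "det E = 1"
    unfolding E_def axis_def det_def UNIV_6
    by (simp add: sum_over_permutations_insert permutes_sing sign_swap_id permutation_swap_id
      sign_compose permutation_compose swap_id_eq)
  ultimately show ?thesis by (simp add: det_mul)
qed

text \<open>
  The squared modulus of the pivot times the squared modulus of the complex 2 by 2 determinant
  of the remaining coordinates.
\<close>

lemma det_complex_frame_block:
  assumes "v$1 = 0" "v$2 = 0" "w$1 = 0" "w$2 = 0"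
  shows "det (complex_frame u v w) = ((u$1)\<^sup>2 + (u$2)\<^sup>2) *
     ((v$3 * w$5 - v$4 * w$6 - (v$5 * w$3 - v$6 * w$4))\<^sup>2
      + (v$3 * w$6 + v$4 * w$5 - (v$5 * w$4 + v$6 * w$3))\<^sup>2)"
  unfolding det_def UNIV_6
  by (simp add: sum_over_permutations_insert permutes_sing sign_swap_id permutation_swap_id
      sign_compose permutation_compose swap_id_eq assms)
    (simp add: power2_eq_square algebra_simps)

text \<open>
  A complex basis is positively oriented: one step of complex Gaussian elimination, on whichever of
  the three vectors has a nonzero first coordinate, reduces to the block shape.
\<close>

lemma det_complex_frame_nonneg: "det (complex_frame u v w) \<ge> 0"
proof -
  have pivot: "det (complex_frame u v w) \<ge> 0" if "z1 u \<noteq> 0" for u v w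
  proof -
    define c d where "c = - z1 v / z1 u" and "d = - z1 w / z1 u"
    define v' w' where "v' = v + Re c *\<^sub>R u + Im c *\<^sub>R J0 u"
      and "w' = w + Re d *\<^sub>R u + Im d *\<^sub>R J0 u"
    have "z1 v' = z1 v + c * z1 u" "z1 w' = z1 w + d * z1 u"
      unfolding v'_def w'_def by (simp_all add: complex_eq_iff)
    then have "z1 v' = 0" "z1 w' = 0"
      using that by (simp_all add: c_def d_def)
    then have "v'$1 = 0" "v'$2 = 0" "w'$1 = 0" "w'$2 = 0"
      by (simp_all add: z1_def complex_eq_iff)
    from det_complex_frame_block[OF this] have "det (complex_frame u v' w') \<ge> 0" by simp
    then show ?thesis unfolding v'_def w'_def det_complex_frame_eliminate .
  qed
  consider "z1 u \<noteq> 0" | "z1 v \<noteq> 0" | "z1 w \<noteq> 0" | "z1 u = 0" "z1 v = 0" "z1 w = 0" by blast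
  then show ?thesis
  proof cases
    case 4
    then have "column 1 (complex_frame u v w) = 0"
      by (simp add: column_def vec_eq_iff forall_6 z1_def complex_eq_iff)
    then show ?thesis by (simp add: det_zero_column)
  qed (metis pivot det_complex_frame_rotate)+
qed

section \<open>Invariant geometry of the Iwasawa manifold\<close>

lemma coframe_eq: "coframe p \<xi> = cvec (\<xi>$1) (\<xi>$2) (p$1 * \<xi>$2 - \<xi>$3)"
  by (simp add: coframe_def cvec_def)

lemma inv_field_eq: "inv_field x p = vector [z1 x, z2 x, p$1 * z2 x - z3 x]"
  unfolding inv_field_def
proof (rule inv_f_eq)
  show "inj (coframe p)"
    by (rule injI) (auto simp: coframe_eq z_eq_iff vec_eq_iff forall_3)
  show "coframe p (vector [z1 x, z2 x, p$1 * z2 x - z3 x]) = x"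
    by (simp add: coframe_eq)
qed

lemma coframe_inv_field [simp]: "coframe p (inv_field x p) = x"
  by (simp add: coframe_eq inv_field_eq)

lemma inv_field_coframe [simp]: "inv_field (coframe p \<xi>) p = \<xi>"
  by (simp add: coframe_eq inv_field_eq vec_eq_iff forall_3)

lemma coframe_eq_iff: "coframe p \<xi> = coframe p \<eta> \<longleftrightarrow> \<xi> = \<eta>"
  by (metis inv_field_coframe)

lemma linear_coframe: "linear (coframe p)"
  by (rule linearI) (simp_all add: coframe_eq z_eq_iff scaleR_conv_of_real[where 'a=complex] algebra_simps)

text \<open>
  For a field that descends to the quotient these components are lattice-invariant functions, and
  for a left-invariant field they are constant. Computing with them replaces transformation by
  \<open>d L\<^sub>M\<close> with plain invariance.
\<close>

definition frame_comp :: "vfield \<Rightarrow> complex^3 \<Rightarrow> real^6" where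
  "frame_comp X p = coframe p (X p)"

text \<open>
  The part of the coframe that depends on the base point, coming from the term \<open>z\<^sup>1 dz\<^sup>2\<close>. Splitting
  it off leaves a constant linear map, and the twist is bilinear, so both differentiate easily.
\<close>

definition coframe_twist :: "complex^3 \<Rightarrow> complex^3 \<Rightarrow> real^6" where
  "coframe_twist p \<xi> = cvec 0 0 (p$1 * \<xi>$2)"

lemma bounded_bilinear_coframe_twist: "bounded_bilinear coframe_twist"
  unfolding bilinear_conv_bounded_bilinear[symmetric] bilinear_def
  by (auto intro!: linearI simp: coframe_twist_def z_eq_iff scaleR_conv_of_real[where 'a=complex] algebra_simps)

lemma bounded_linear_coframe: "bounded_linear (coframe p)"
  using linear_coframe linear_conv_bounded_linear by blast

lemma coframe_split: "coframe p \<xi> = coframe 0 \<xi> + coframe_twist p \<xi>"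
  by (simp add: coframe_eq coframe_twist_def z_eq_iff)

text \<open>
  The Maurer-Cartan equation: differentiating the twist and skew-symmetrizing gives the
  Lie bracket of the components.
\<close>

lemma coframe_twist_antisym: "coframe_twist \<eta> \<xi> - coframe_twist \<xi> \<eta> = bracket (coframe p \<xi>) (coframe p \<eta>)"
  by (simp add: coframe_twist_def z_eq_iff coframe_eq algebra_simps)

lemma frame_comp_has_derivative:
  assumes "(Y has_derivative Y') (at p)"
  shows "(frame_comp Y has_derivative (\<lambda>\<xi>. coframe p (Y' \<xi>) + coframe_twist \<xi> (Y p))) (at p)"
proof -
  have "((\<lambda>q. coframe 0 (Y q) + coframe_twist q (Y q)) has_derivative
      (\<lambda>\<xi>. coframe 0 (Y' \<xi>) + (coframe_twist p (Y' \<xi>) + coframe_twist \<xi> (Y p)))) (at p)"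
    by (intro has_derivative_add bounded_linear.has_derivative[OF bounded_linear_coframe assms]
        bounded_bilinear.FDERIV[OF bounded_bilinear_coframe_twist has_derivative_ident assms])
  moreover have "frame_comp Y = (\<lambda>q. coframe 0 (Y q) + coframe_twist q (Y q))"
    by (auto simp: frame_comp_def fun_eq_iff coframe_split[symmetric])
  ultimately show ?thesis
    by (simp add: coframe_split[of p] add.assoc)
qed

text \<open>
  In components the bracket of fields consists of the derivatives of the components and, because
  the frame itself moves, the algebraic bracket.
\<close>

lemma coframe_lie_bracket:
  assumes "X differentiable at p" "Y differentiable at p"
  shows "coframe p (lie_bracket X Y p) =
    frechet_derivative (frame_comp Y) (at p) (X p) - frechet_derivative (frame_comp X) (at p) (Y p)
      + bracket (frame_comp X p) (frame_comp Y p)"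
proof -
  interpret linear "coframe p" by (rule linear_coframe)
  have D: "frechet_derivative (frame_comp Z) (at p) \<xi>
      = coframe p (frechet_derivative Z (at p) \<xi>) + coframe_twist \<xi> (Z p)"
    if "Z differentiable at p" for Z \<xi>
    using frechet_derivative_at[OF frame_comp_has_derivative[OF frechet_derivative_works[THEN iffD1, OF that]]]
    by (metis (lifting))
  show ?thesis
    using coframe_twist_antisym[of "Y p" "X p" p]
    by (simp add: D[OF assms(1)] D[OF assms(2)] lie_bracket_def diff frame_comp_def algebra_simps)
qed

lemma smooth_on_frame_comp:
  assumes "open S" "smooth_on S X"
  shows "smooth_on S (frame_comp X)"
proof -
  have "smooth_on S (\<lambda>q. coframe 0 (X q) + coframe_twist q (X q))"
    by (intro smooth_on_add smooth_on_linear[OF bounded_linear_coframe]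
      smooth_on_bilinear[OF bounded_bilinear_coframe_twist] smooth_on_ident assms)
  moreover have "frame_comp X = (\<lambda>q. coframe 0 (X q) + coframe_twist q (X q))"
    by (auto simp: frame_comp_def fun_eq_iff coframe_split[symmetric])
  ultimately show ?thesis by simp
qed

text \<open>
  The counterpart of \<open>coframe_twist\<close> for the dual frame.
\<close>

definition frame_twist :: "complex^3 \<Rightarrow> real^6 \<Rightarrow> complex^3" where
  "frame_twist p x = vector [0, 0, p$1 * z2 x]"

lemma bounded_bilinear_frame_twist: "bounded_bilinear frame_twist"
  unfolding bilinear_conv_bounded_bilinear[symmetric] bilinear_def
  by (auto intro!: linearI simp: frame_twist_def vec_eq_iff forall_3 scaleR_conv_of_real[where 'a=complex] algebra_simps)

lemma inv_field_split: "inv_field x p = inv_field x 0 + frame_twist p x"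
  by (simp add: inv_field_eq frame_twist_def vec_eq_iff forall_3)

lemma bounded_linear_inv_field: "bounded_linear (\<lambda>x. inv_field x p)"
  unfolding linear_conv_bounded_linear[symmetric]
  by (rule linearI)
    (simp_all add: inv_field_eq vec_eq_iff forall_3 scaleR_conv_of_real[where 'a=complex] algebra_simps)

lemma smooth_on_inv_field:
  assumes "open S" "smooth_on S x"
  shows "smooth_on S (\<lambda>p. inv_field (x p) p)"
proof -
  have "smooth_on S (\<lambda>p. inv_field (x p) 0 + frame_twist p (x p))"
    by (intro smooth_on_add smooth_on_linear[OF bounded_linear_inv_field]
      smooth_on_bilinear[OF bounded_bilinear_frame_twist] smooth_on_ident assms)
  then show ?thesis by (simp add: inv_field_split[symmetric])
qed

lemma left_translation_heis:
  "left_translation (heis m) z = vector [m$1 + z$1, m$2 + z$2, z$3 + m$1 * z$2 + m$3]"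
  by (simp add: left_translation_def heis_coords_def heis_def matrix_matrix_mult_def sum_3 vec_eq_iff forall_3)

lemma has_derivative_left_translation:
  "(left_translation (heis m) has_derivative (\<lambda>\<xi>. vector [\<xi>$1, \<xi>$2, \<xi>$3 + m$1 * \<xi>$2])) (at p)"
proof -
  define L :: "complex^3 \<Rightarrow> complex^3" where "L = (\<lambda>\<xi>. vector [\<xi>$1, \<xi>$2, \<xi>$3 + m$1 * \<xi>$2])"
  have "linear L"
    by (rule linearI) (simp_all add: L_def vec_eq_iff forall_3 scaleR_conv_of_real[where 'a=complex] algebra_simps)
  then have "bounded_linear L" by (simp add: linear_conv_bounded_linear)
  then have "((\<lambda>z. L z + m) has_derivative L) (at p)"
    by (auto intro!: derivative_eq_intros bounded_linear_imp_has_derivative)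
  moreover have "left_translation (heis m) = (\<lambda>z. L z + m)"
    by (simp add: fun_eq_iff left_translation_heis L_def vec_eq_iff forall_3)
  ultimately show ?thesis by (simp add: L_def)
qed

text \<open>
  Shifting \<open>z\<^sup>1\<close> by \<open>m\<^sup>1\<close> changes \<open>z\<^sup>1 dz\<^sup>2\<close> by \<open>m\<^sup>1 dz\<^sup>2\<close>, which is also the change of \<open>dz\<^sup>3\<close>.
\<close>

lemma coframe_left_invariant:
  assumes "M \<in> heis_lattice"
  shows "coframe (left_translation M p) (frechet_derivative (left_translation M) (at p) \<xi>) = coframe p \<xi>"
proof -
  obtain m where "M = heis m" using assms by (auto simp: heis_lattice_def)
  then show ?thesis
    by (simp add: frechet_derivative_at[OF has_derivative_left_translation, symmetric]
        left_translation_heis coframe_eq algebra_simps)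
qed

lemma left_translation_differentiable:
  assumes "M \<in> heis_lattice"
  shows "left_translation M differentiable at p"
  using assms has_derivative_left_translation by (auto simp: heis_lattice_def differentiable_def)

lemma frame_comp_left_invariant:
  assumes "X \<in> vector_fields" "M \<in> heis_lattice"
  shows "frame_comp X (left_translation M p) = frame_comp X p"
  using assms coframe_left_invariant[OF assms(2)] by (simp add: frame_comp_def vector_fields_def)

lemma inv_field_left_invariant:
  assumes "M \<in> heis_lattice"
  shows "inv_field x (left_translation M p) = frechet_derivative (left_translation M) (at p) (inv_field x p)"
  by (metis assms coframe_eq_iff coframe_inv_field coframe_left_invariant)

lemma vector_fields_smooth: "X \<in> vector_fields \<Longrightarrow> smooth_on UNIV X"
  by (simp add: vector_fields_def)

lemma smooth_frame_comp: "X \<in> vector_fields \<Longrightarrow> smooth_on UNIV (frame_comp X)"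
  by (simp add: vector_fields_def smooth_on_frame_comp)

lemma vector_fieldsI:
  assumes "smooth_on UNIV x" "\<And>M p. M \<in> heis_lattice \<Longrightarrow> x (left_translation M p) = x p"
  shows "(\<lambda>p. inv_field (x p) p) \<in> vector_fields"
  using assms by (simp add: vector_fields_def smooth_on_inv_field inv_field_left_invariant)

lemma inv_field_vector_field: "inv_field x \<in> vector_fields"
  using vector_fieldsI[OF smooth_on_const, of x] by simp

lemma derivative_frame_comp_left_invariant:
  assumes "X \<in> vector_fields" "Y \<in> vector_fields" "M \<in> heis_lattice"
  shows "frechet_derivative (frame_comp Y) (at (left_translation M p)) (X (left_translation M p))
    = frechet_derivative (frame_comp Y) (at p) (X p)"
proof -
  have "((frame_comp Y \<circ> left_translation M) has_derivative
      frechet_derivative (frame_comp Y) (at (left_translation M p)) \<circ>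
      frechet_derivative (left_translation M) (at p)) (at p)"
    by (intro diff_chain_at smooth_on_has_derivative[OF smooth_frame_comp] assms UNIV_I
       frechet_derivative_works[THEN iffD1] left_translation_differentiable)
  moreover have "frame_comp Y \<circ> left_translation M = frame_comp Y"
    using frame_comp_left_invariant[OF assms(2,3)] by auto
  ultimately have "frechet_derivative (frame_comp Y) (at p) = 
     frechet_derivative (frame_comp Y) (at (left_translation M p)) \<circ>
      frechet_derivative (left_translation M) (at p)"
    using frechet_derivative_at by metis
  with assms show ?thesis by (simp add: vector_fields_def)
qed

text \<open>
  The flat derivative of the components, corrected by constant coefficients.
\<close>

definition invariant_connection :: "vfield \<Rightarrow> vfield \<Rightarrow> vfield" where
  "invariant_connection X Y p =
     inv_field (frechet_derivative (frame_comp Y) (at p) (X p) + christoffel (frame_comp X p) (frame_comp Y p)) p"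

lemma coframe_invariant_connection:
  assumes "(frame_comp Y has_derivative E) (at p)"
  shows "coframe p (invariant_connection X Y p) = E (X p) + christoffel (frame_comp X p) (frame_comp Y p)"
  using frechet_derivative_at[OF assms] by (simp add: invariant_connection_def)

lemma frame_comp_add: "frame_comp (\<lambda>q. X q + Y q) p = frame_comp X p + frame_comp Y p"
  and frame_comp_scale: "frame_comp (\<lambda>q. f q *\<^sub>R X q) p = f p *\<^sub>R frame_comp X p"
  by (simp_all add: frame_comp_def linear_add[OF linear_coframe] linear_scale[OF linear_coframe])

lemma metric_frame_comp: "metric p (X p) (Y p) = frame_comp X p \<bullet> frame_comp Y p"
  by (simp add: metric_def frame_comp_def)

text \<open>
  Since \<open>LC\<close> is given by choice, one Levi-Civita connection has to be exhibited before anything can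
  be said about it. Each axiom is checked after applying the coframe, where the derivative terms are
  those of the flat connection and \<open>christoffel\<close> supplies the torsion and the metric condition.
\<close>

lemma levi_civita_invariant_connection: "levi_civita invariant_connection"
proof -
  let ?D = invariant_connection
  let ?d = "\<lambda>Y p. frechet_derivative (frame_comp Y) (at p)"
  interpret christoffel: bounded_bilinear christoffel by (rule bounded_bilinear_christoffel)
  have der: "(frame_comp Y has_derivative ?d Y p) (at p)" if "Y \<in> vector_fields" for Y p
    by (rule smooth_on_has_derivative[OF smooth_frame_comp[OF that] UNIV_I])
  note cD = coframe_invariant_connection
  have closed: "?D X Y \<in> vector_fields" if "X \<in> vector_fields" "Y \<in> vector_fields" for X Y
    unfolding invariant_connection_def
    by (rule vector_fieldsI)
      (use that in \<open>simp_all add: smooth_on_add smooth_on_derivative_along smooth_frame_comp vector_fields_smooth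
        smooth_on_bilinear[OF bounded_bilinear_christoffel] frame_comp_left_invariant derivative_frame_comp_left_invariant\<close>)
  have add: "?D (\<lambda>q. X q + Y q) Z p = ?D X Z p + ?D Y Z p \<and>
      ?D X (\<lambda>q. Y q + Z q) p = ?D X Y p + ?D X Z p"
    if "X \<in> vector_fields" "Y \<in> vector_fields" "Z \<in> vector_fields" for X Y Z p
  proof -
    have "(frame_comp (\<lambda>q. Y q + Z q) has_derivative (\<lambda>\<xi>. ?d Y p \<xi> + ?d Z p \<xi>)) (at p)"
      unfolding frame_comp_add[abs_def] by (intro has_derivative_add der that)
    then have "coframe p (?D X (\<lambda>q. Y q + Z q) p) = coframe p (?D X Y p + ?D X Z p)"
      by (simp add: cD cD[OF der] that frame_comp_add linear_add[OF linear_coframe] christoffel.add_right)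
    moreover have "coframe p (?D (\<lambda>q. X q + Y q) Z p) = coframe p (?D X Z p + ?D Y Z p)"
      by (simp add: cD[OF der] that frame_comp_add linear_add[OF linear_coframe] christoffel.add_left
          linear_add[OF has_derivative_linear[OF der]])
    ultimately show ?thesis by (simp add: coframe_eq_iff)
  qed
  have scale: "?D (\<lambda>q. f q *\<^sub>R X q) Y p = f p *\<^sub>R ?D X Y p \<and>
      ?D X (\<lambda>q. f q *\<^sub>R Y q) p = dir_deriv X f p *\<^sub>R Y p + f p *\<^sub>R ?D X Y p"
    if "f \<in> smooth_functions" "X \<in> vector_fields" "Y \<in> vector_fields" for f X Y p
  proof -
    have f: "(f has_derivative frechet_derivative f (at p)) (at p)"
      using that(1) smooth_on_has_derivative by (auto simp: smooth_functions_def)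
    have "(frame_comp (\<lambda>q. f q *\<^sub>R Y q) has_derivative
        (\<lambda>\<xi>. f p *\<^sub>R ?d Y p \<xi> + frechet_derivative f (at p) \<xi> *\<^sub>R frame_comp Y p)) (at p)"
      unfolding frame_comp_scale[abs_def] by (intro has_derivative_scaleR f der that)
    then have "coframe p (?D X (\<lambda>q. f q *\<^sub>R Y q) p)
        = coframe p (dir_deriv X f p *\<^sub>R Y p + f p *\<^sub>R ?D X Y p)"
      by (simp add: cD cD[OF der] that linear_add[OF linear_coframe]
          linear_scale[OF linear_coframe] christoffel.scaleR_right dir_deriv_def frame_comp_def algebra_simps)
    moreover have "coframe p (?D (\<lambda>q. f q *\<^sub>R X q) Y p) = coframe p (f p *\<^sub>R ?D X Y p)"
      by (simp add: cD[OF der] that frame_comp_scale linear_scale[OF linear_coframe] christoffel.scaleR_left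
          linear_scale[OF has_derivative_linear[OF der]] algebra_simps)
    ultimately show ?thesis by (simp add: coframe_eq_iff)
  qed
  have metric: "dir_deriv X (\<lambda>q. metric q (Y q) (Z q)) p
      = metric p (?D X Y p) (Z p) + metric p (Y p) (?D X Z p)"
    if "X \<in> vector_fields" "Y \<in> vector_fields" "Z \<in> vector_fields" for X Y Z p
  proof -
    have "((\<lambda>q. frame_comp Y q \<bullet> frame_comp Z q) has_derivative
        (\<lambda>\<xi>. frame_comp Y p \<bullet> ?d Z p \<xi> + ?d Y p \<xi> \<bullet> frame_comp Z p)) (at p)"
      by (intro has_derivative_inner der that)
    from frechet_derivative_at[OF this, symmetric] have "dir_deriv X (\<lambda>q. metric q (Y q) (Z q)) p
        = frame_comp Y p \<bullet> ?d Z p (X p) + ?d Y p (X p) \<bullet> frame_comp Z p"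
      by (simp add: dir_deriv_def metric_frame_comp)
    then show ?thesis
      using christoffel_metric[of "frame_comp X p" "frame_comp Y p" "frame_comp Z p"]
      by (simp add: metric_frame_comp[of p "?D X Y" Z] metric_frame_comp[of p Y "?D X Z"] frame_comp_def[of "?D X Y"]
          frame_comp_def[of "?D X Z"] cD[OF der] that inner_add_left inner_add_right)
  qed
  have torsion: "?D X Y p - ?D Y X p = lie_bracket X Y p"
    if "X \<in> vector_fields" "Y \<in> vector_fields" for X Y p
  proof -
    have diff: "Z differentiable at p" if "Z \<in> vector_fields" for Z
      using smooth_on_has_derivative[OF vector_fields_smooth[OF that] UNIV_I]
      by (auto simp: differentiable_def)
    have "coframe p (?D X Y p - ?D Y X p) = coframe p (lie_bracket X Y p)"
      by (simp add: coframe_lie_bracket diff that linear_diff[OF linear_coframe] cD[OF der]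
          christoffel_torsion_free[symmetric])
    then show ?thesis by (simp only: coframe_eq_iff)
  qed
  show ?thesis
    unfolding levi_civita_def using closed add scale metric torsion by blast
qed

lemma frame_comp_inv_field [simp]: "frame_comp (inv_field x) = (\<lambda>p. x)"
  by (simp add: frame_comp_def fun_eq_iff)

lemma inv_field_differentiable: "inv_field x differentiable at p"
  using smooth_on_has_derivative[OF vector_fields_smooth[OF inv_field_vector_field] UNIV_I]
  by (auto simp: differentiable_def)

lemma coframe_lie_bracket_inv_field: "coframe p (lie_bracket (inv_field x) (inv_field y) p) = bracket x y"
  by (simp add: coframe_lie_bracket inv_field_differentiable)

lemma levi_civita_metric:
  assumes "levi_civita D" "X \<in> vector_fields" "Y \<in> vector_fields" "Z \<in> vector_fields"
  shows "dir_deriv X (\<lambda>q. metric q (Y q) (Z q)) p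
    = metric p (D X Y p) (Z p) + metric p (Y p) (D X Z p)"
  using assms unfolding levi_civita_def by (elim conjE) simp

lemma levi_civita_torsion_free:
  assumes "levi_civita D" "X \<in> vector_fields" "Y \<in> vector_fields"
  shows "D X Y p - D Y X p = lie_bracket X Y p"
  using assms unfolding levi_civita_def by (elim conjE) simp

text \<open>
  On invariant fields inner products are constant, so the two defining properties of \<open>LC\<close> become
  the hypotheses of the algebraic Koszul argument. In particular the coefficients do not depend on
  the point.
\<close>

lemma nabla_coeff_eq: "nabla_coeff p = koszul_form"
proof -
  have LC: "levi_civita LC"
    unfolding LC_def using levi_civita_invariant_connection by (rule someI[where P = levi_civita])
  define G where "G x y = coframe p (LC (inv_field x) (inv_field y) p)" for x y
  have "G x y - G y x = bracket x y" for x y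
  proof -
    have "LC (inv_field x) (inv_field y) p - LC (inv_field y) (inv_field x) p
        = lie_bracket (inv_field x) (inv_field y) p"
      by (rule levi_civita_torsion_free[OF LC inv_field_vector_field inv_field_vector_field])
    then show ?thesis
      unfolding G_def linear_diff[OF linear_coframe, symmetric] by (simp add: coframe_lie_bracket_inv_field)
  qed
  moreover have "G x y \<bullet> z + y \<bullet> G x z = 0" for x y z
  proof -
    have "dir_deriv (inv_field x) (\<lambda>q. metric q (inv_field y q) (inv_field z q)) p = 0"
      by (simp add: metric_def dir_deriv_def frechet_derivative_const)
    then show ?thesis
      using levi_civita_metric[OF LC, of "inv_field x" "inv_field y" "inv_field z" p]
      by (simp add: metric_def G_def inv_field_vector_field)
  qed
  ultimately have "G x y \<bullet> z = koszul_form x y z" for x y z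
    by (rule koszul)
  then show ?thesis
    by (simp add: fun_eq_iff nabla_coeff_def metric_def G_def)
qed

text \<open>
  The Nijenhuis tensor evaluated on invariant fields.
\<close>

definition nijenhuis_alg :: "real^6^6 \<Rightarrow> real^6 \<Rightarrow> real^6 \<Rightarrow> real^6" where
  "nijenhuis_alg J x y = bracket (J *v x) (J *v y) - J *v bracket (J *v x) y - J *v bracket x (J *v y) - bracket x y"

lemma frame_comp_act: "frame_comp (act J X) = (\<lambda>p. J *v frame_comp X p)"
  by (simp add: frame_comp_def act_def fun_eq_iff)

lemma coframe_act: "coframe p (act J X p) = J *v coframe p (X p)"
  by (simp add: act_def)

lemma square_minus_one_apply:
  fixes J :: "real^'n^'n"
  assumes "J ** J = - mat 1"
  shows "J *v (J *v x) = - x"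
proof -
  have "J *v (J *v x) = (0 - mat 1) *v x"
    by (simp add: matrix_vector_mul_assoc assms)
  then show ?thesis by (simp only: matrix_vector_mult_diff_rdistrib) simp
qed

text \<open>
  Tensoriality: when all four brackets are expanded in components, \<open>J\<close> has constant coefficients and
  commutes with differentiation, and the derivative terms cancel in pairs because \<open>J\<^sup>2 = - 1\<close>.
\<close>

lemma coframe_nijenhuis:
  assumes J: "J ** J = - mat 1" and "X \<in> vector_fields" "Y \<in> vector_fields"
  shows "coframe p (nijenhuis J X Y p) = nijenhuis_alg J (frame_comp X p) (frame_comp Y p)"
proof -
  have JJ: "J *v (J *v x) = - x" for x
    using J by (rule square_minus_one_apply)
  have sm: "smooth_on UNIV (act J Z)" if "Z \<in> vector_fields" for Z
    unfolding act_def frame_comp_def[symmetric]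
    by (rule smooth_on_inv_field[OF open_UNIV smooth_on_linear[OF matrix_vector_mul_bounded_linear
            open_UNIV smooth_frame_comp[OF that]]])
  have diff: "Z differentiable at p" if "smooth_on UNIV Z" for Z :: vfield
    using smooth_on_has_derivative[OF that UNIV_I] by (auto simp: differentiable_def)
  have dact: "frechet_derivative (frame_comp (act J Z)) (at p) \<xi> = J *v frechet_derivative (frame_comp Z) (at p) \<xi>"
    if "Z \<in> vector_fields" for Z \<xi>
    unfolding frame_comp_act
    using frechet_derivative_at[OF bounded_linear.has_derivative[OF matrix_vector_mul_bounded_linear
          smooth_on_has_derivative[OF smooth_frame_comp[OF that] UNIV_I]]] by metis
  have cact: "frame_comp (act J Z) p = J *v frame_comp Z p" for Z by (simp add: frame_comp_act)
  let ?dX = "frechet_derivative (frame_comp X) (at p)" and ?dY = "frechet_derivative (frame_comp Y) (at p)"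
  have "coframe p (lie_bracket (act J X) (act J Y) p) = J *v ?dY (act J X p) - J *v ?dX (act J Y p)
      + bracket (J *v frame_comp X p) (J *v frame_comp Y p)"
    using assms(2,3) by (simp only: coframe_lie_bracket[OF diff diff, OF sm sm] dact cact)
  moreover have "coframe p (act J (lie_bracket (act J X) Y) p)
      = J *v ?dY (act J X p) + ?dX (Y p) + J *v bracket (J *v frame_comp X p) (frame_comp Y p)"
    using assms(2,3)
    by (simp only: coframe_act coframe_lie_bracket[OF diff diff, OF sm vector_fields_smooth] dact cact
        matrix_vector_right_distrib matrix_vector_mult_diff_distrib JJ) simp
  moreover have "coframe p (act J (lie_bracket X (act J Y)) p)
      = - ?dY (X p) - J *v ?dX (act J Y p) + J *v bracket (frame_comp X p) (J *v frame_comp Y p)"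
    using assms(2,3)
    by (simp only: coframe_act coframe_lie_bracket[OF diff diff, OF vector_fields_smooth sm] dact cact
        matrix_vector_right_distrib matrix_vector_mult_diff_distrib JJ)
  moreover have "coframe p (lie_bracket X Y p) = ?dY (X p) - ?dX (Y p) + bracket (frame_comp X p) (frame_comp Y p)"
    using assms(2,3) by (simp only: coframe_lie_bracket[OF diff diff, OF vector_fields_smooth vector_fields_smooth])
  ultimately show ?thesis
    by (simp add: nijenhuis_def linear_diff[OF linear_coframe] nijenhuis_alg_def)
qed

lemma class_W34_iff:
  assumes "J ** J = - mat 1"
  shows "class_W34 J \<longleftrightarrow> (\<forall>x y. nijenhuis_alg J x y = 0)"
proof
  assume W: "class_W34 J"
  show "\<forall>x y. nijenhuis_alg J x y = 0"
  proof (intro allI)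
    fix x y
    have "nijenhuis J (inv_field x) (inv_field y) 0 = 0"
      using W inv_field_vector_field by (auto simp: class_W34_def)
    then show "nijenhuis_alg J x y = 0"
      using coframe_nijenhuis[OF assms inv_field_vector_field[of x] inv_field_vector_field[of y], of 0]
      by (simp add: linear_0[OF linear_coframe])
  qed
next
  assume N: "\<forall>x y. nijenhuis_alg J x y = 0"
  have "coframe p (nijenhuis J X Y p) = coframe p 0" if "X \<in> vector_fields" "Y \<in> vector_fields" for X Y p
    using coframe_nijenhuis[OF assms that] N by (simp add: linear_0[OF linear_coframe])
  then show "class_W34 J" by (simp add: class_W34_def coframe_eq_iff)
qed

section \<open>Structures split along a complex line\<close>

text \<open>
  For \<open>v \<noteq> 0\<close> the horizontal space is the orthogonal sum of \<open>\<complex>v\<close> and \<open>\<complex>(- cnj v\<^sub>2, cnj v\<^sub>1)\<close>.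
  The next two functions are the complex coordinates along these lines, scaled by
  \<open>norm_sq v\<close> so that no division occurs.
\<close>

definition line_coord :: "complex^2 \<Rightarrow> real^6 \<Rightarrow> complex" where
  "line_coord v x = cnj (v$1) * z1 x + cnj (v$2) * z2 x"
definition perp_coord :: "complex^2 \<Rightarrow> real^6 \<Rightarrow> complex" where
  "perp_coord v x = v$1 * z2 x - v$2 * z1 x"
definition norm_sq :: "complex^2 \<Rightarrow> real" where
  "norm_sq v = (cmod (v$1))\<^sup>2 + (cmod (v$2))\<^sup>2"

lemma norm_sq_eq: "complex_of_real (norm_sq v) = v$1 * cnj (v$1) + v$2 * cnj (v$2)"
  by (simp add: norm_sq_def complex_norm_square[symmetric])

lemma norm_sq_pos: "v \<noteq> 0 \<Longrightarrow> norm_sq v > 0"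
  by (auto simp: norm_sq_def vec_eq_iff forall_2 add_pos_nonneg add_nonneg_pos)

lemma norm_sq_z:
  "of_real (norm_sq v) * z1 x = v$1 * line_coord v x - cnj (v$2) * perp_coord v x"
  "of_real (norm_sq v) * z2 x = v$2 * line_coord v x + cnj (v$1) * perp_coord v x"
  by (simp_all add: norm_sq_eq line_coord_def perp_coord_def algebra_simps)

lemma adapted_eqI:
  assumes "v \<noteq> 0" "line_coord v x = line_coord v y" "perp_coord v x = perp_coord v y" "z3 x = z3 y"
  shows "x = y"
proof -
  have "complex_of_real (norm_sq v) \<noteq> 0" using norm_sq_pos[OF assms(1)] by simp
  then have "z1 x = z1 y" "z2 x = z2 y"
    using norm_sq_z[of v x] norm_sq_z[of v y] assms by (metis mult_left_cancel)+
  then show ?thesis using assms(4) by (rule z_eqI)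
qed

lemma adapted_linear [simp]:
  "line_coord v 0 = 0" "line_coord v (x + y) = line_coord v x + line_coord v y" "line_coord v (- x) = - line_coord v x"
  "line_coord v (x - y) = line_coord v x - line_coord v y" "perp_coord v (x - y) = perp_coord v x - perp_coord v y"
  "line_coord v (r *\<^sub>R x) = of_real r * line_coord v x"
  "perp_coord v 0 = 0" "perp_coord v (x + y) = perp_coord v x + perp_coord v y" "perp_coord v (- x) = - perp_coord v x"
  "perp_coord v (r *\<^sub>R x) = of_real r * perp_coord v x"
  "line_coord v (J0 x) = \<i> * line_coord v x" "perp_coord v (J0 x) = \<i> * perp_coord v x"
  by (simp_all add: line_coord_def perp_coord_def algebra_simps)

lemma inner_adapted:
  assumes "v \<noteq> 0"
  shows "x \<bullet> y = Re ((line_coord v x * cnj (line_coord v y) + perp_coord v x * cnj (perp_coord v y)) / of_real (norm_sq v)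
     + z3 x * cnj (z3 y))"
proof -
  have "(line_coord v x * cnj (line_coord v y) + perp_coord v x * cnj (perp_coord v y))
      = of_real (norm_sq v) * (z1 x * cnj (z1 y) + z2 x * cnj (z2 y))"
    by (simp add: norm_sq_eq line_coord_def perp_coord_def algebra_simps)
  then have "(line_coord v x * cnj (line_coord v y) + perp_coord v x * cnj (perp_coord v y)) / of_real (norm_sq v)
      = z1 x * cnj (z1 y) + z2 x * cnj (z2 y)"
    using norm_sq_pos[OF assms] by simp
  then show ?thesis by (simp only: inner_z)
qed

text \<open>
  The bracket is a multiple of the complex determinant on \<open>\<complex>\<^sup>2\<close>, so it pairs the line with its
  orthogonal complement in every adapted basis.
\<close>

lemma z3_bracket_adapted:
  assumes "v \<noteq> 0"
  shows "z3 (bracket x y) = (perp_coord v x * line_coord v y - line_coord v x * perp_coord v y) / of_real (norm_sq v)"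
proof -
  have "perp_coord v x * line_coord v y - line_coord v x * perp_coord v y = of_real (norm_sq v) * z3 (bracket x y)"
    by (simp add: norm_sq_eq line_coord_def perp_coord_def algebra_simps)
  then show ?thesis using norm_sq_pos[OF assms] by simp
qed

lemma matrix_vector_mul_self:
  fixes f :: "real^'n \<Rightarrow> real^'m"
  assumes "linear f"
  shows "matrix f *v x = f x"
  by (metis assms matrix_vector_mul)

text \<open>
  \<open>e$1 J0\<close> on \<open>\<complex>v\<close>, \<open>e$2 J0\<close> on its horizontal orthogonal complement and \<open>e$3 J0\<close> on
  \<open>\<langle>e\<^sub>5, e\<^sub>6\<rangle>\<close>, written as \<open>e$2 J0\<close> on \<open>\<complex>\<^sup>2\<close> plus a multiple of \<open>J0\<close> after projection to \<open>\<complex>v\<close>.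
\<close>

definition split_J :: "real^3 \<Rightarrow> complex^2 \<Rightarrow> real^6 \<Rightarrow> real^6" where
  "split_J e v x = cvec
     (\<i> * (of_real (e$2) * z1 x + of_real (e$1 - e$2) * line_coord v x / of_real (norm_sq v) * v$1))
     (\<i> * (of_real (e$2) * z2 x + of_real (e$1 - e$2) * line_coord v x / of_real (norm_sq v) * v$2))
     (\<i> * of_real (e$3) * z3 x)"

definition split_J_matrix :: "real^3 \<Rightarrow> complex^2 \<Rightarrow> real^6^6" where
  "split_J_matrix e v = matrix (split_J e v)"

lemma split_J_adapted:
  assumes "v \<noteq> 0"
  shows "line_coord v (split_J e v x) = \<i> * of_real (e$1) * line_coord v x"
    "perp_coord v (split_J e v x) = \<i> * of_real (e$2) * perp_coord v x"
    "z3 (split_J e v x) = \<i> * of_real (e$3) * z3 x"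
proof -
  define q where "q = of_real (e$1 - e$2) * line_coord v x / of_real (norm_sq v)"
  have "line_coord v (split_J e v x) = \<i> * (of_real (e$2) * line_coord v x + q * of_real (norm_sq v))"
    unfolding split_J_def q_def[symmetric] by (simp add: line_coord_def norm_sq_eq algebra_simps)
  also have "q * of_real (norm_sq v) = of_real (e$1 - e$2) * line_coord v x"
    using norm_sq_pos[OF assms] by (simp add: q_def)
  finally show "line_coord v (split_J e v x) = \<i> * of_real (e$1) * line_coord v x"
    by (simp add: algebra_simps)
  show "perp_coord v (split_J e v x) = \<i> * of_real (e$2) * perp_coord v x"
    by (simp add: split_J_def perp_coord_def algebra_simps)
qed (simp add: split_J_def)

lemma linear_split_J: "v \<noteq> 0 \<Longrightarrow> linear (split_J e v)"
  by (rule linearI; rule adapted_eqI[of v]) (simp_all add: split_J_adapted algebra_simps)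

lemma split_J_matrix_apply: "v \<noteq> 0 \<Longrightarrow> split_J_matrix e v *v x = split_J e v x"
  by (simp add: split_J_matrix_def linear_split_J matrix_vector_mul_self)

definition is_sign :: "real \<Rightarrow> bool" where "is_sign r \<longleftrightarrow> r = 1 \<or> r = - 1"

lemma is_sign_square:
  assumes "is_sign r"
  shows "\<i> * of_real r * (\<i> * of_real r * h) = - h" "r * r = 1"
  using assms by (auto simp: is_sign_def)

lemma minus_mat_1_apply: "(- mat 1 :: real^'n^'n) *v x = - x"
proof -
  have "(- mat 1 :: real^'n^'n) *v x = (0 - mat 1) *v x" by simp
  also have "\<dots> = - x" by (simp only: matrix_vector_mult_diff_rdistrib) simp
  finally show ?thesis .
qed

lemma split_J_square:
  assumes "v \<noteq> 0" "\<And>i. is_sign (e$i)"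
  shows "split_J_matrix e v ** split_J_matrix e v = - mat 1"
proof -
  have JJ: "split_J e v (split_J e v x) = - x" for x
    by (rule adapted_eqI[OF assms(1)])
      (simp_all only: split_J_adapted[OF assms(1)] is_sign_square[OF assms(2)] adapted_linear z_linear)
  have "(split_J_matrix e v ** split_J_matrix e v) *v x = (- mat 1) *v x" for x
    by (simp only: matrix_vector_mul_assoc[symmetric] split_J_matrix_apply[OF assms(1)] JJ minus_mat_1_apply)
  then show ?thesis by (simp add: matrix_eq)
qed

lemma orthogonal_split_J:
  assumes "v \<noteq> 0" "\<And>i. is_sign (e$i)"
  shows "orthogonal_matrix (split_J_matrix e v)"
proof -
  have "orthogonal_transformation (split_J e v)"
    unfolding orthogonal_transformation_def
    using assms(2)[of 1] assms(2)[of 2] assms(2)[of 3]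
    by (auto simp: linear_split_J[OF assms(1)] inner_adapted[OF assms(1)] split_J_adapted[OF assms(1)] is_sign_def)
  then show ?thesis by (simp add: split_J_matrix_def orthogonal_transformation_matrix)
qed

text \<open>
  In adapted coordinates \<open>J\<close> multiplies by \<open>i e$1\<close>, \<open>i e$2\<close>, \<open>i e$3\<close>, and the bracket pairs the
  first two and takes values in the third.
\<close>

lemma nijenhuis_alg_split_J:
  assumes "v \<noteq> 0"
  shows "z3 (nijenhuis_alg (split_J_matrix e v) x y) = of_real (e$3 * (e$1 + e$2) - e$1 * e$2 - 1) * z3 (bracket x y)"
     "z1 (nijenhuis_alg (split_J_matrix e v) x y) = 0" "z2 (nijenhuis_alg (split_J_matrix e v) x y) = 0"
proof -
  have z: "z1 (split_J e v x) = 0 \<and> z2 (split_J e v x) = 0" if "z1 x = 0" "z2 x = 0" for x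
    using that by (simp add: split_J_def line_coord_def)
  show "z3 (nijenhuis_alg (split_J_matrix e v) x y) = of_real (e$3 * (e$1 + e$2) - e$1 * e$2 - 1) * z3 (bracket x y)"
    using norm_sq_pos[OF assms] unfolding nijenhuis_alg_def
    by (simp add: split_J_matrix_apply assms z3_bracket_adapted[OF assms] split_J_adapted field_simps del: z_ops(6))
  show "z1 (nijenhuis_alg (split_J_matrix e v) x y) = 0" "z2 (nijenhuis_alg (split_J_matrix e v) x y) = 0"
    unfolding nijenhuis_alg_def by (simp_all add: split_J_matrix_apply assms z)
qed

lemma J0_axis: "J0 (axis 1 1) = axis 2 1" "J0 (axis 3 1) = axis 4 1" "J0 (axis 5 1) = axis 6 1"
  by (simp_all add: vec_eq_iff forall_6 axis_def)

lemma row_times_transpose: "(M ** transpose A) $ i = A *v (M $ i)"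
  for A M :: "real^'n^'n"
  by (simp add: vec_eq_iff matrix_matrix_mult_def matrix_vector_mult_def transpose_def mult.commute)

text \<open>
  The columns of the matrix of a complex linear map are the images of a complex basis, each followed
  by its multiple by \<open>J0\<close>.
\<close>

lemma det_complex_linear_nonneg:
  assumes "linear A" "\<And>x. A (J0 x) = J0 (A x)"
  shows "det (matrix A) \<ge> 0"
proof -
  have "transpose (matrix A) = complex_frame (A (axis 1 1)) (A (axis 3 1)) (A (axis 5 1))"
    unfolding assms(2)[symmetric] J0_axis
    by (simp add: vec_eq_iff forall_6 transpose_def matrix_def)
  then show ?thesis
    using det_complex_frame_nonneg by (metis det_transpose)
qed

text \<open>
  Conjugation of those complex coordinates whose sign is \<open>- 1\<close>.
\<close>

definition conj_diag :: "real^3 \<Rightarrow> real^6^6" where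
  "conj_diag e = (\<chi> i j. if i = j then (vector [1, e$1, 1, e$2, 1, e$3] :: real^6) $ i else 0)"

lemma det_conj_diag: "det (conj_diag e) = e$1 * e$2 * e$3"
proof -
  have "det (conj_diag e) = (\<Prod>i\<in>UNIV. conj_diag e $ i $ i)"
    by (rule det_diagonal) (simp add: conj_diag_def)
  also have "\<dots> = e$1 * e$2 * e$3"
    unfolding UNIV_6 by (simp add: conj_diag_def)
  finally show ?thesis .
qed

lemma conj_diag_apply: "conj_diag e *v x = vector [x$1, e$1 * x$2, x$3, e$2 * x$4, x$5, e$3 * x$6]"
  by (simp add: vec_eq_iff forall_6 conj_diag_def matrix_vector_mult_def sum_6)

definition adapted_coords :: "complex^2 \<Rightarrow> real^6 \<Rightarrow> real^6" where
  "adapted_coords v x = cvec (line_coord v x) (perp_coord v x) (z3 x)"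

lemma det_adapted_coords_pos:
  assumes "v \<noteq> 0"
  shows "det (matrix (adapted_coords v)) > 0"
proof -
  have lin: "linear (adapted_coords v)"
    by (rule linearI) (simp_all add: adapted_coords_def z_eq_iff)
  have "inj (adapted_coords v)"
    by (rule injI, rule adapted_eqI[OF assms]) (simp_all only: adapted_coords_def z_eq_iff z_cvec)
  with lin have "det (matrix (adapted_coords v)) \<noteq> 0"
    by (simp add: det_nz_iff_inj)
  moreover have "det (matrix (adapted_coords v)) \<ge> 0"
    by (rule det_complex_linear_nonneg[OF lin]) (simp add: adapted_coords_def z_eq_iff)
  ultimately show ?thesis by simp
qed

text \<open>
  Adapted coordinates followed by conjugation where the sign is negative give a real linear map \<open>T\<close>
  with \<open>T J = J0 T\<close>. It carries a basis \<open>(x, J x, y, J y, z, J z)\<close> to the real basis of a complex one,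
  which is positive, so the orientation of \<open>J\<close> is the sign of \<open>det T\<close>, which is the product of the three signs.
\<close>

lemma positive_orientation_split_J:
  assumes "v \<noteq> 0" "\<And>i. is_sign (e$i)"
  shows "(\<exists>x y z. det (vector [x, split_J_matrix e v *v x, y, split_J_matrix e v *v y, z, split_J_matrix e v *v z] :: real^6^6) > 0)
     \<longleftrightarrow> e$1 * e$2 * e$3 = 1"
proof -
  let ?J = "\<lambda>x. split_J_matrix e v *v x"
  define T where "T = conj_diag e ** matrix (adapted_coords v)"
  have lin: "linear (adapted_coords v)"
    by (rule linearI) (simp_all add: adapted_coords_def z_eq_iff)
  have Tx: "T *v x = conj_diag e *v adapted_coords v x" for x
    by (simp add: T_def matrix_vector_mul_assoc[symmetric] matrix_vector_mul_self[OF lin])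
  have TJ: "T *v ?J x = J0 (T *v x)" for x
    using assms(2)[of 1] assms(2)[of 2] assms(2)[of 3]
    by (auto simp: Tx conj_diag_apply split_J_matrix_apply[OF assms(1)] adapted_coords_def split_J_adapted[OF assms(1)] is_sign_def cvec_def
        vec_eq_iff forall_6)
  have s: "e$1 * e$2 * e$3 = 1 \<or> e$1 * e$2 * e$3 = - 1"
    using assms(2)[of 1] assms(2)[of 2] assms(2)[of 3] by (auto simp: is_sign_def)
  have detT: "det T = e$1 * e$2 * e$3 * det (matrix (adapted_coords v))"
    by (simp add: T_def det_mul det_conj_diag)
  have det: "det (vector [x, ?J x, y, ?J y, z, ?J z] :: real^6^6) * det T
      = det (complex_frame (T *v x) (T *v y) (T *v z))" for x y z
  proof -
    have "(vector [x, ?J x, y, ?J y, z, ?J z] :: real^6^6) ** transpose T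
        = complex_frame (T *v x) (T *v y) (T *v z)"
      unfolding vec_eq_iff[where 'b = 6 and 'a = "real^6"] forall_6
      by (simp only: row_times_transpose vector_6 TJ simp_thms)
    from this[symmetric] show ?thesis by (simp only: det_mul det_transpose)
  qed
  show ?thesis
  proof
    assume "\<exists>x y z. det (vector [x, ?J x, y, ?J y, z, ?J z] :: real^6^6) > 0"
    then obtain x y z where pos: "det (vector [x, ?J x, y, ?J y, z, ?J z] :: real^6^6) > 0" by blast
    have "det (vector [x, ?J x, y, ?J y, z, ?J z] :: real^6^6) * det T \<ge> 0"
      unfolding det by (rule det_complex_frame_nonneg)
    with pos have "det T \<ge> 0" by (simp add: zero_le_mult_iff)
    with det_adapted_coords_pos[OF assms(1)] s show "e$1 * e$2 * e$3 = 1"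
      by (auto simp: detT)
  next
    assume one: "e$1 * e$2 * e$3 = 1"
    then have "det T > 0" using det_adapted_coords_pos[OF assms(1)] by (simp add: detT)
    then have "invertible T" by (simp add: invertible_det_nz)
    then obtain B where "T ** B = mat 1" by (auto simp: invertible_def)
    then have "T *v (B *v y) = y" for y by (simp add: matrix_vector_mul_assoc)
    then obtain x y z where xyz: "T *v x = axis 1 1" "T *v y = axis 3 1" "T *v z = axis 5 1" by metis
    \<comment> \<open>The preimages of the standard complex basis are a witness, with determinant \<open>1 / det T\<close>.\<close>
    have "complex_frame (axis 1 1) (axis 3 1) (axis 5 1) = mat 1"
      by (simp only: J0_axis) (simp add: vec_eq_iff forall_6 mat_def axis_def)
    with det[of x y z] have "det (vector [x, ?J x, y, ?J y, z, ?J z] :: real^6^6) * det T = 1"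
      by (simp only: xyz det_I)
    with \<open>det T > 0\<close> have "det (vector [x, ?J x, y, ?J y, z, ?J z] :: real^6^6) > 0"
      by (metis zero_less_mult_pos2 zero_less_one)
    then show "\<exists>x y z. det (vector [x, ?J x, y, ?J y, z, ?J z] :: real^6^6) > 0" by blast
  qed
qed

lemma split_J_OCS_pos:
  assumes "v \<noteq> 0" "\<And>i. is_sign (e$i)"
  shows "split_J_matrix e v \<in> OCS_pos \<longleftrightarrow> e$1 * e$2 * e$3 = 1"
  using positive_orientation_split_J[OF assms] assms
  by (simp add: OCS_pos_def orthogonal_split_J split_J_square)

section \<open>Planes of class V5 are horizontal complex lines\<close>

definition hvec :: "complex^2 \<Rightarrow> real^6" where "hvec v = cvec (v$1) (v$2) 0"
definition hline :: "complex^2 \<Rightarrow> (real^6) set" where "hline v = hvec ` complex_line v"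

lemma z_hvec [simp]: "z1 (hvec v) = v$1" "z2 (hvec v) = v$2" "z3 (hvec v) = 0"
  by (simp_all add: hvec_def)

lemma adapted_hvec: "line_coord v (hvec v) = of_real (norm_sq v)" "perp_coord v (hvec v) = 0"
  by (simp_all add: line_coord_def perp_coord_def norm_sq_eq algebra_simps)

lemma mem_hline_combination:
  "x \<in> hline v \<longleftrightarrow> (\<exists>s t. x = s *\<^sub>R hvec v + t *\<^sub>R J0 (hvec v))"
proof -
  have "hvec (c *s v) = Re c *\<^sub>R hvec v + Im c *\<^sub>R J0 (hvec v)" for c
    by (simp add: z_eq_iff complex_eq_iff)
  then have "x \<in> hline v \<longleftrightarrow> (\<exists>c. x = Re c *\<^sub>R hvec v + Im c *\<^sub>R J0 (hvec v))"
    by (auto simp: hline_def complex_line_def image_iff)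
  also have "\<dots> \<longleftrightarrow> (\<exists>s t. x = s *\<^sub>R hvec v + t *\<^sub>R J0 (hvec v))"
    by (metis complex.sel)
  finally show ?thesis .
qed

lemma mem_span_pair: "x \<in> span {p, q} \<longleftrightarrow> (\<exists>s t. x = s *\<^sub>R p + t *\<^sub>R q)"
  for x :: "'a::real_vector"
  unfolding span_insert[of p] span_singleton by (simp add: image_iff diff_eq_eq add.commute)

lemma hline_span: "hline v = span {hvec v, J0 (hvec v)}"
  by (auto simp: mem_hline_combination mem_span_pair)

lemma subspace_hline: "subspace (hline v)"
  by (simp add: hline_span)

lemma mem_hline:
  assumes "v \<noteq> 0"
  shows "x \<in> hline v \<longleftrightarrow> perp_coord v x = 0 \<and> z3 x = 0"
proof
  assume "x \<in> hline v"
  then show "perp_coord v x = 0 \<and> z3 x = 0"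
    by (auto simp: mem_hline_combination adapted_hvec)
next
  assume x: "perp_coord v x = 0 \<and> z3 x = 0"
  define c where "c = line_coord v x / of_real (norm_sq v)"
  have "x = Re c *\<^sub>R hvec v + Im c *\<^sub>R J0 (hvec v)"
  proof (rule adapted_eqI[OF assms])
    have "line_coord v x = c * of_real (norm_sq v)" using norm_sq_pos[OF assms] by (simp add: c_def)
    then show "line_coord v x = line_coord v (Re c *\<^sub>R hvec v + Im c *\<^sub>R J0 (hvec v))"
      by (simp add: adapted_hvec complex_eq_iff)
  qed (use x in \<open>simp_all add: adapted_hvec\<close>)
  then show "x \<in> hline v" unfolding mem_hline_combination by blast
qed

lemma bracket_skew: "bracket x x = 0" "bracket y x = - bracket x y"
  by (simp_all add: z_eq_iff)

lemma bracket_vertical: "z1 x = 0 \<Longrightarrow> z2 x = 0 \<Longrightarrow> bracket x y = 0" "z1 x = 0 \<Longrightarrow> z2 x = 0 \<Longrightarrow> bracket y x = 0"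
  by (simp_all add: z_eq_iff)

lemma bracket_bilinear:
  "bracket (x + x') y = bracket x y + bracket x' y" "bracket x (y + y') = bracket x y + bracket x y'"
  "bracket (r *\<^sub>R x) y = r *\<^sub>R bracket x y" "bracket x (r *\<^sub>R y) = r *\<^sub>R bracket x y"
  by (simp_all add: z_eq_iff algebra_simps)

lemma bracket_horizontal: "z3 z = 0 \<Longrightarrow> bracket x y \<bullet> z = 0"
  by (simp add: inner_z)

lemma bracket_hline: "v \<noteq> 0 \<Longrightarrow> x \<in> hline v \<Longrightarrow> y \<in> hline v \<Longrightarrow> bracket x y = 0"
  by (rule adapted_eqI[of v]) (simp_all add: line_coord_def perp_coord_def z3_bracket_adapted[of v] mem_hline del: z_ops(6))

lemma koszul_form_skew: "koszul_form x y z - koszul_form y x z = bracket x y \<bullet> z"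
  using bracket_skew(2)[of x y] bracket_skew(2)[of y z] bracket_skew(2)[of x z] by (simp add: koszul_form_def field_simps)

lemma koszul_form_diag: "koszul_form x x z = bracket z x \<bullet> x"
  using bracket_skew(2)[of x z] by (simp add: koszul_form_def bracket_skew(1))

lemma orthonormal_basis_some:
  assumes "subspace U"
  shows "orthonormal_basis U (SOME B. orthonormal_basis U B)"
proof -
  have "\<exists>B. orthonormal_basis U B"
    using orthonormal_basis_subspace[OF assms] unfolding orthonormal_basis_def by metis
  then show ?thesis by (rule someI_ex)
qed

lemma orthonormal_basis_expansion:
  assumes "orthonormal_basis U B" "x \<in> U"
  shows "(\<Sum>b\<in>B. (x \<bullet> b) *\<^sub>R b) = x"
proof -
  have "0 \<notin> B" using assms(1) by (auto simp: orthonormal_basis_def)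
  then have "finite B"
    using assms(1) pairwise_orthogonal_independent independent_imp_finite
    unfolding orthonormal_basis_def by blast
  with assms show ?thesis
    by (intro orthonormal_basis_expand) (auto simp: orthonormal_basis_def)
qed

text \<open>
  The trace of \<open>ad z\<close> over \<open>U\<close>. The image of \<open>ad z\<close> is spanned by \<open>e\<^sub>5\<close> and \<open>e\<^sub>6\<close>, so only the components
  of the basis vectors along these two contribute; since both lie in \<open>U\<close>, summing over the basis
  evaluates \<open>ad z\<close> on them, where it vanishes.
\<close>

lemma trace_koszul_form_zero:
  assumes "orthonormal_basis U B" "cvec 0 0 1 \<in> U" "cvec 0 0 \<i> \<in> U"
  shows "(\<Sum>b\<in>B. koszul_form b b z) = 0"
proof -
  have sum0: "(\<Sum>b\<in>B. (bracket z b \<bullet> u) * (u \<bullet> b)) = 0" if "u \<in> U" "z1 u = 0" "z2 u = 0" for u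
  proof -
    interpret linear "bracket z"
      by (rule linearI) (simp_all add: bracket_bilinear)
    have "(\<Sum>b\<in>B. (bracket z b \<bullet> u) * (u \<bullet> b)) = bracket z (\<Sum>b\<in>B. (u \<bullet> b) *\<^sub>R b) \<bullet> u"
      by (simp add: sum scale inner_sum_left mult.commute)
    also have "\<dots> = 0"
      by (simp add: orthonormal_basis_expansion[OF assms(1) that(1)] bracket_vertical that)
    finally show ?thesis .
  qed
  have "koszul_form b b z = (bracket z b \<bullet> cvec 0 0 1) * (cvec 0 0 1 \<bullet> b) + (bracket z b \<bullet> cvec 0 0 \<i>) * (cvec 0 0 \<i> \<bullet> b)" for b
    by (simp add: koszul_form_diag inner_z)
  then show ?thesis
    using sum0[OF assms(2)] sum0[OF assms(3)] by (simp add: sum.distrib)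
qed

text \<open>
  A complex line is abelian and orthogonal to all brackets. This kills \<open>A\<close> and the skew part of \<open>B\<close>;
  the trace of \<open>B\<close> is the trace of the preceding lemma.
\<close>

lemma OPS_class_hline:
  assumes "v \<noteq> 0"
  shows "OPS_class {5} (hline v, Or)"
proof -
  let ?V = "hline v"
  have zV: "z3 x = 0" if "x \<in> ?V" for x
    using that assms by (simp add: mem_hline)
  have A: "koszul_form x y z = 0" if "x \<in> ?V" "y \<in> ?V" for x y z
    using bracket_hline[OF assms that] bracket_horizontal[OF zV] that by (simp add: koszul_form_def)
  have B: "koszul_form x y z - koszul_form y x z = 0" if "z \<in> ?V" for x y z
    using bracket_horizontal[OF zV[OF that]] by (simp add: koszul_form_skew)
  have vert: "cvec 0 0 c \<in> ?V\<^sup>\<bottom>" for c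
    using zV by (auto simp: orthogonal_comp_def orthogonal_def inner_z mem_hline_combination)
  have "trace_part ?V koszul_form x y z = 0" for x y z
  proof -
    have "(SOME B. orthonormal_basis ?V B) \<subseteq> ?V"
      using orthonormal_basis_some[OF subspace_hline, of v] span_superset
      unfolding orthonormal_basis_def by blast
    then have "(\<Sum>b\<in>(SOME B. orthonormal_basis ?V B). koszul_form b b z) = 0"
      using A by (intro sum.neutral) auto
    then show ?thesis by (simp add: trace_part_def)
  qed
  moreover have "trace_part (?V\<^sup>\<bottom>) koszul_form x y z = 0" for x y z
    using trace_koszul_form_zero[OF orthonormal_basis_some[OF subspace_orthogonal_comp] vert vert]
    by (simp add: trace_part_def)
  ultimately show ?thesis
    using A B by (auto simp: OPS_class_def torsion_component_zero_def nabla_coeff_eq vanishes_on_def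
        skew_part_def tracefree_sym_part_def)
qed

text \<open>
  The three components of \<open>A\<close> add up to \<open>A\<close>, whatever orthonormal basis is chosen for the trace.
\<close>

lemma OPS_class5_tensors:
  assumes "OPS_class {5} (W, Or)"
  shows "x \<in> W \<Longrightarrow> y \<in> W \<Longrightarrow> z \<in> W\<^sup>\<bottom> \<Longrightarrow> koszul_form x y z = 0"
    "x \<in> W\<^sup>\<bottom> \<Longrightarrow> y \<in> W\<^sup>\<bottom> \<Longrightarrow> z \<in> W \<Longrightarrow> bracket x y \<bullet> z = 0"
proof -
  have T: "torsion_component_zero k W 0" if "k \<in> {1..6} - {5}" for k
    using assms that by (simp add: OPS_class_def)
  show "koszul_form x y z = 0" if "x \<in> W" "y \<in> W" "z \<in> W\<^sup>\<bottom>"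
  proof -
    have "skew_part koszul_form x y z = 0" "tracefree_sym_part W koszul_form x y z = 0" "trace_part W koszul_form x y z = 0"
      using T[of 1] T[of 2] T[of 3] that
      by (simp_all add: torsion_component_zero_def nabla_coeff_eq vanishes_on_def)
    then show ?thesis by (simp add: skew_part_def tracefree_sym_part_def)
  qed
  show "bracket x y \<bullet> z = 0" if "x \<in> W\<^sup>\<bottom>" "y \<in> W\<^sup>\<bottom>" "z \<in> W"
    using T[of 4] that koszul_form_skew[of x y z]
    by (simp add: torsion_component_zero_def nabla_coeff_eq vanishes_on_def skew_part_def)
qed

text \<open>
  The geometric heart of the condition on \<open>V\<close>: a totally geodesic plane is a subalgebra, hence
  abelian, then each of its vectors is horizontal or vertical, and a vertical one contradicts the
  integrability of the complement.
\<close>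

lemma OPS_class5_abelian_horizontal:
  assumes W: "W = span {a, b}" and ops: "OPS_class {5} (W, Or)"
  shows "x \<in> W \<Longrightarrow> y \<in> W \<Longrightarrow> bracket x y = 0" and "x \<in> W \<Longrightarrow> z3 x = 0"
proof -
  note A = OPS_class5_tensors(1)[OF ops] and B = OPS_class5_tensors(2)[OF ops]
  have sub: "subspace W" by (simp add: W)
  have comb: "\<exists>s t. x = s *\<^sub>R a + t *\<^sub>R b" if "x \<in> W" for x
    using that unfolding W mem_span_pair .
  define n where "n = bracket a b"
  have ab: "a \<in> W" "b \<in> W" by (auto simp: W span_base)
  have "bracket a b \<bullet> z = 0" if "z \<in> W\<^sup>\<bottom>" for z
    using A[OF ab that] A[OF ab(2,1) that] koszul_form_skew[of a b z] by simp
  then have "n \<in> W\<^sup>\<bottom>\<^sup>\<bottom>"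
    by (simp add: orthogonal_comp_def[of "W\<^sup>\<bottom>"] orthogonal_def n_def inner_commute)
  then have "n \<in> W" by (simp add: orthogonal_comp_self[OF sub])
  then obtain s t where n: "n = s *\<^sub>R a + t *\<^sub>R b" using comb by blast
  \<comment> \<open>A bracket is central, so pairing \<open>n\<close> with \<open>b\<close> and \<open>a\<close> shows that its coefficients kill \<open>n\<close>.\<close>
  have "bracket n b = 0" "bracket a n = 0" unfolding n_def by (simp_all add: bracket_vertical)
  then have "s *\<^sub>R n = 0" "t *\<^sub>R n = 0"
    by (simp_all add: n bracket_bilinear bracket_skew(1)) (simp_all add: n_def[symmetric] n)
  then have n0: "n = 0" using n by auto
  show abel: "bracket x y = 0" if xy: "x \<in> W" "y \<in> W" for x y
  proof -
    obtain s t where "x = s *\<^sub>R a + t *\<^sub>R b" using comb[OF xy(1)] by blast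
    moreover obtain s' t' where "y = s' *\<^sub>R a + t' *\<^sub>R b" using comb[OF xy(2)] by blast
    ultimately show ?thesis
      using n0 by (simp add: bracket_bilinear bracket_skew(1) bracket_skew(2)[of b a] n_def)
  qed
  have geod: "bracket z x \<bullet> x = 0" if "x \<in> W" for x z
  proof -
    have "z \<in> W + W\<^sup>\<bottom>" using subspace_sum_orthogonal_comp[OF sub] by simp
    then obtain z' z'' where z: "z = z' + z''" "z' \<in> W" "z'' \<in> W\<^sup>\<bottom>"
      by (auto simp: set_plus_def)
    then show ?thesis
      using abel[OF z(2) that] A[OF that that z(3)] by (simp add: bracket_bilinear koszul_form_diag)
  qed
  have dich: "z3 x = 0 \<or> z1 x = 0 \<and> z2 x = 0" if "x \<in> W" for x
  proof -
    \<comment> \<open>A vector \<open>z\<close> for which \<open>[z, x]\<close> is a nonnegative multiple of the vertical part of \<open>x\<close>.\<close>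
    have "bracket (cvec (- cnj (z2 x) * z3 x) (cnj (z1 x) * z3 x) 0) x \<bullet> x
        = Re ((z1 x * cnj (z1 x) + z2 x * cnj (z2 x)) * (z3 x * cnj (z3 x)))"
      by (simp add: inner_z algebra_simps)
    also have "\<dots> = ((cmod (z1 x))\<^sup>2 + (cmod (z2 x))\<^sup>2) * (cmod (z3 x))\<^sup>2"
      by (simp add: complex_norm_square[symmetric] flip: of_real_add of_real_mult of_real_power)
    finally have "((cmod (z1 x))\<^sup>2 + (cmod (z2 x))\<^sup>2) * (cmod (z3 x))\<^sup>2 = 0"
      using geod[OF that] by simp
    then show ?thesis by (auto simp: add_nonneg_eq_0_iff)
  qed
  show "z3 x = 0" if "x \<in> W" for x
  proof (rule ccontr)
    assume x: "z3 x \<noteq> 0"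
    \<comment> \<open>A vertical and a horizontal vector of \<open>W\<close> would have a sum that is neither.\<close>
    have y: "z1 y = 0 \<and> z2 y = 0" if "y \<in> W" for y
      using dich[OF that] dich[OF \<open>x \<in> W\<close>] dich[OF subspace_add[OF sub \<open>x \<in> W\<close> that]] x by auto
    \<comment> \<open>Now \<open>W\<close> is vertical, so the complement contains \<open>\<complex>\<^sup>2\<close>, whose brackets fill the vertical space.\<close>
    then have "cvec c d 0 \<in> W\<^sup>\<bottom>" for c d
      by (auto simp: orthogonal_comp_def orthogonal_def inner_z)
    then have "bracket (cvec 1 0 0) (cvec 0 d 0) \<bullet> x = 0" for d
      using B that by blast
    moreover have "bracket (cvec 1 0 0) (cvec 0 (z3 x) 0) \<bullet> x = - (cmod (z3 x))\<^sup>2"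
      unfolding cmod_power2 by (simp add: inner_z power2_eq_square)
    ultimately have "(cmod (z3 x))\<^sup>2 = 0" by (metis neg_equal_0_iff_equal)
    with x show False by simp
  qed
qed

section \<open>Classification of the mixed structures\<close>

lemma positive_basesI:
  "p = c11 *\<^sub>R a + c12 *\<^sub>R b \<Longrightarrow> q = c21 *\<^sub>R a + c22 *\<^sub>R b \<Longrightarrow> c11 * c22 - c12 * c21 > 0 \<Longrightarrow>
     (p, q) \<in> positive_bases a b"
  unfolding positive_bases_def by blast

lemma positive_bases_subset:
  assumes "(x, y) \<in> positive_bases a b"
  shows "positive_bases x y \<subseteq> positive_bases a b"
proof -
  obtain a11 a12 a21 a22 where xy: "x = a11 *\<^sub>R a + a12 *\<^sub>R b" "y = a21 *\<^sub>R a + a22 *\<^sub>R b"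
    and d: "a11 * a22 - a12 * a21 > 0"
    using assms unfolding positive_bases_def by auto
  show ?thesis
  proof
    fix q assume "q \<in> positive_bases x y"
    then obtain b11 b12 b21 b22 where q: "q = (b11 *\<^sub>R x + b12 *\<^sub>R y, b21 *\<^sub>R x + b22 *\<^sub>R y)"
      and d': "b11 * b22 - b12 * b21 > 0"
      unfolding positive_bases_def by auto
    have "b11 *\<^sub>R x + b12 *\<^sub>R y = (b11 * a11 + b12 * a21) *\<^sub>R a + (b11 * a12 + b12 * a22) *\<^sub>R b"
      "b21 *\<^sub>R x + b22 *\<^sub>R y = (b21 * a11 + b22 * a21) *\<^sub>R a + (b21 * a12 + b22 * a22) *\<^sub>R b"
      by (simp_all add: xy algebra_simps)
    moreover have "(b11 * a11 + b12 * a21) * (b21 * a12 + b22 * a22)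
        - (b11 * a12 + b12 * a22) * (b21 * a11 + b22 * a21)
        = (b11 * b22 - b12 * b21) * (a11 * a22 - a12 * a21)"
      by algebra
    ultimately show "q \<in> positive_bases a b"
      using mult_pos_pos[OF d' d] unfolding q by (intro positive_basesI) auto
  qed
qed

lemma positive_bases_sym:
  assumes "(x, y) \<in> positive_bases a b"
  shows "(a, b) \<in> positive_bases x y"
proof -
  obtain a11 a12 a21 a22 where xy: "x = a11 *\<^sub>R a + a12 *\<^sub>R b" "y = a21 *\<^sub>R a + a22 *\<^sub>R b"
    and d: "a11 * a22 - a12 * a21 > 0"
    using assms unfolding positive_bases_def by auto
  define D where "D = a11 * a22 - a12 * a21"
  have D: "D > 0" using d by (simp add: D_def)
  have "D *\<^sub>R a = a22 *\<^sub>R x + (- a12) *\<^sub>R y" "D *\<^sub>R b = (- a21) *\<^sub>R x + a11 *\<^sub>R y"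
    by (simp_all add: D_def xy algebra_simps)
  then have "a = (1 / D) *\<^sub>R (a22 *\<^sub>R x + (- a12) *\<^sub>R y)" "b = (1 / D) *\<^sub>R ((- a21) *\<^sub>R x + a11 *\<^sub>R y)"
    using D by (metis divide_self_if less_irrefl scaleR_one scaleR_scaleR times_divide_eq_left mult_1)+
  then have ab: "a = (a22 / D) *\<^sub>R x + (- a12 / D) *\<^sub>R y" "b = (- a21 / D) *\<^sub>R x + (a11 / D) *\<^sub>R y"
    by (simp_all add: scaleR_add_right scaleR_diff_right)
  have "(a22 / D) * (a11 / D) - (- a12 / D) * (- a21 / D) = D / (D * D)"
    by (simp add: diff_divide_distrib[symmetric] mult.commute) (simp add: D_def mult.commute)
  then have "(a22 / D) * (a11 / D) - (- a12 / D) * (- a21 / D) > 0" using D by simp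
  from positive_basesI[OF ab this] show ?thesis .
qed

lemma positive_bases_eqI:
  "(x, y) \<in> positive_bases a b \<Longrightarrow> positive_bases a b = positive_bases x y"
  by (simp add: positive_bases_subset positive_bases_sym subset_antisym)

text \<open>
  The signs of \<open>J\<close> on the line, on its horizontal complement and on \<open>\<langle>e\<^sub>5, e\<^sub>6\<rangle>\<close> in the three
  families.
\<close>

definition signs :: "3 \<Rightarrow> real^3" where
  "signs i = (if i = 1 then vector [1, 1, 1] else if i = 2 then vector [1, - 1, - 1] else vector [- 1, 1, - 1])"

definition standard_mixed :: "real^3 \<Rightarrow> complex^2 \<Rightarrow> mixed" where
  "standard_mixed e v = (split_J_matrix e v, hline v, positive_bases (hvec v) (split_J_matrix e v *v hvec v))"

lemma is_sign_signs: "is_sign (signs i $ k)"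
  using exhaust_3[of i] exhaust_3[of k] by (auto simp: signs_def is_sign_def)

text \<open>
  Positive orientation and vanishing of the Nijenhuis tensor select three of the eight choices of
  signs.
\<close>

lemma signs_iff:
  assumes "\<And>k. is_sign (e$k)"
  shows "e$1 * e$2 * e$3 = 1 \<and> e$3 * (e$1 + e$2) - e$1 * e$2 - 1 = 0 \<longleftrightarrow> (\<exists>i. e = signs i)"
proof
  assume "e$1 * e$2 * e$3 = 1 \<and> e$3 * (e$1 + e$2) - e$1 * e$2 - 1 = 0"
  then have "e = signs 1 \<or> e = signs 2 \<or> e = signs 3"
    using assms[of 1] assms[of 2] assms[of 3]
    by (auto simp: is_sign_def signs_def vec_eq_iff forall_3)
  then show "\<exists>i. e = signs i" by blast
qed (use exhaust_3 in \<open>auto simp: signs_def\<close>)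

lemma split_J_hvec: "v \<noteq> 0 \<Longrightarrow> split_J_matrix e v *v hvec v = (e$1) *\<^sub>R J0 (hvec v)"
  by (rule adapted_eqI[of v]) (simp_all add: split_J_matrix_apply split_J_adapted adapted_hvec)

lemma split_J_hline:
  assumes "v \<noteq> 0" "x \<in> hline v"
  shows "split_J_matrix e v *v x = (e$1) *\<^sub>R J0 x"
  using assms by (intro adapted_eqI[of v]) (simp_all add: split_J_matrix_apply split_J_adapted mem_hline)

lemma J0_hline: "v \<noteq> 0 \<Longrightarrow> x \<in> hline v \<Longrightarrow> J0 x \<in> hline v"
  by (simp add: mem_hline)

lemma hvec_nonzero: "v \<noteq> 0 \<Longrightarrow> hvec v \<noteq> 0"
  by (auto simp: z_eq_iff vec_eq_iff forall_2)

lemma J0_J0 [simp]: "J0 (J0 x) = - x" "J0 0 = 0"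
  by (simp_all add: z_eq_iff)

lemma J0_linear: "J0 (x + y) = J0 x + J0 y" "J0 (r *\<^sub>R x) = r *\<^sub>R J0 x"
  by (simp_all add: z_eq_iff algebra_simps)

lemma inner_J0 [simp]: "J0 x \<bullet> J0 y = x \<bullet> y" "x \<bullet> J0 x = 0" "J0 x \<bullet> x = 0"
  by (simp_all add: inner_z algebra_simps)

lemma independent_J0:
  assumes "x \<noteq> 0" "r \<noteq> 0"
  shows "x \<noteq> r *\<^sub>R J0 x" "independent {x, r *\<^sub>R J0 x}"
proof -
  have J: "J0 x \<noteq> 0" using assms inner_J0(1)[of x x] by (metis inner_eq_zero_iff)
  have "x \<bullet> (r *\<^sub>R J0 x) = 0" by simp
  then show ne: "x \<noteq> r *\<^sub>R J0 x" using assms by (metis inner_eq_zero_iff)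
  show "independent {x, r *\<^sub>R J0 x}"
    using assms J ne
    by (intro pairwise_orthogonal_independent) (auto simp: pairwise_def orthogonal_def)
qed

text \<open>
  Any nonzero vector \<open>w\<close> of a complex line together with \<open>\<plusminus> J0 w\<close> defines the same orientation, because
  passing from one such vector to another is multiplication by a complex number.
\<close>

lemma positive_bases_rotate:
  assumes "s \<noteq> 0 \<or> t \<noteq> 0" "y = r *\<^sub>R J0 x" "is_sign r"
  shows "(s *\<^sub>R x + t *\<^sub>R J0 x, r *\<^sub>R J0 (s *\<^sub>R x + t *\<^sub>R J0 x)) \<in> positive_bases x y"
proof -
  have "s *\<^sub>R x + t *\<^sub>R J0 x = s *\<^sub>R x + (r * t) *\<^sub>R y"
    "r *\<^sub>R J0 (s *\<^sub>R x + t *\<^sub>R J0 x) = (- r * t) *\<^sub>R x + s *\<^sub>R y"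
    using assms(3) by (auto simp: assms(2) J0_linear algebra_simps is_sign_def)
  moreover have "s * s - (r * t) * (- r * t) > 0" 
  proof -
    have "s * s - (r * t) * (- r * t) = s\<^sup>2 + t\<^sup>2"
      using is_sign_square(2)[OF assms(3)] by (simp add: power2_eq_square)
    then show ?thesis using assms(1) by (simp add: sum_power2_gt_zero_iff)
  qed
  ultimately show ?thesis by (rule positive_basesI)
qed

lemma standard_mixed_class:
  assumes "v \<noteq> 0"
  shows "standard_mixed (signs i) v \<in> mixed_W34_V5"
proof -
  let ?e = "signs i" let ?J = "split_J_matrix ?e v" let ?u = "hvec v"
  have sq: "?J ** ?J = - mat 1" by (rule split_J_square[OF assms is_sign_signs])
  have val: "?e$1 * ?e$2 * ?e$3 = 1" "?e$3 * (?e$1 + ?e$2) - ?e$1 * ?e$2 - 1 = 0"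
    using signs_iff[OF is_sign_signs] by blast+
  have ocs: "?J \<in> OCS_pos"
    using split_J_OCS_pos[OF assms is_sign_signs] val by simp
  have "nijenhuis_alg ?J x y = 0" for x y
    using nijenhuis_alg_split_J[OF assms, of ?e x y] unfolding val(2) by (simp add: z_eq_iff)
  then have w34: "class_W34 ?J" by (simp add: class_W34_iff[OF sq])
  have Ju: "?J *v ?u = (?e$1) *\<^sub>R J0 ?u" by (rule split_J_hvec[OF assms])
  have r: "?e$1 \<noteq> 0" using is_sign_signs[of i 1] by (auto simp: is_sign_def)
  have "span {?u, ?J *v ?u} = hline v"
  proof (intro set_eqI iffI)
    fix x assume "x \<in> hline v"
    then obtain s t where x: "x = s *\<^sub>R ?u + t *\<^sub>R J0 ?u" unfolding mem_hline_combination by blast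
    have "x = s *\<^sub>R ?u + (t * ?e$1) *\<^sub>R (?J *v ?u)"
      using is_sign_square(2)[OF is_sign_signs[of i 1]] by (simp add: Ju x mult.assoc)
    then show "x \<in> span {?u, ?J *v ?u}" unfolding mem_span_pair by blast
  qed (auto simp: mem_span_pair mem_hline_combination Ju)
  moreover have "?u \<noteq> ?J *v ?u" "independent {?u, ?J *v ?u}"
    unfolding Ju using independent_J0[OF hvec_nonzero[OF assms] r] by auto
  ultimately have plane: "(hline v, positive_bases ?u (?J *v ?u)) \<in> oriented_planes"
    unfolding oriented_planes_def by blast
  have inv: "?J *v x \<in> hline v" if "x \<in> hline v" for x
    by (simp add: split_J_hline[OF assms that] J0_hline[OF assms that] subspace_scale[OF subspace_hline])
  have pos: "(x, ?J *v x) \<in> positive_bases ?u (?J *v ?u)" if x: "x \<in> hline v" "x \<noteq> 0" for x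
  proof -
    obtain s t where st: "x = s *\<^sub>R ?u + t *\<^sub>R J0 ?u" using x(1) unfolding mem_hline_combination by blast
    with x(2) have "s \<noteq> 0 \<or> t \<noteq> 0" by auto
    from positive_bases_rotate[OF this Ju is_sign_signs] show ?thesis
      unfolding split_J_hline[OF assms x(1)] unfolding st .
  qed
  show ?thesis
    using ocs plane inv pos w34 OPS_class_hline[OF assms]
    by (simp add: standard_mixed_def mixed_W34_V5_def mixed_structures_def)
qed

lemma inner_hvec: "x \<bullet> hvec v = Re (line_coord v x)" "x \<bullet> J0 (hvec v) = Im (line_coord v x)"
  by (simp_all add: inner_z line_coord_def algebra_simps)

text \<open>
  Spans the horizontal complex line orthogonal to \<open>v\<close>, and has the same length as \<open>v\<close>.
\<close>

definition hperp :: "complex^2 \<Rightarrow> real^6" where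
  "hperp v = cvec (- cnj (v$2)) (cnj (v$1)) 0"

lemma inner_hperp: "x \<bullet> hperp v = Re (perp_coord v x)"
  by (simp add: inner_z perp_coord_def hperp_def algebra_simps)

lemma adapted_hperp: "line_coord v (hperp v) = 0" "perp_coord v (hperp v) = of_real (norm_sq v)" "z3 (hperp v) = 0"
  by (simp_all add: line_coord_def perp_coord_def norm_sq_eq hperp_def algebra_simps)

abbreviation e5 :: "real^6" where "e5 \<equiv> cvec 0 0 1"

lemma adapted_e5: "line_coord v e5 = 0" "perp_coord v e5 = 0"
  by (simp_all add: line_coord_def perp_coord_def)

lemma inner_e5: "x \<bullet> e5 = Re (z3 x)" "x \<bullet> J0 e5 = Im (z3 x)"
  by (simp_all add: inner_z)

lemma adapted_expansion:
  assumes "v \<noteq> 0"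
  shows "x = (Re (line_coord v x) / norm_sq v) *\<^sub>R hvec v + (Im (line_coord v x) / norm_sq v) *\<^sub>R J0 (hvec v)
    + (Re (perp_coord v x) / norm_sq v) *\<^sub>R hperp v + (Im (perp_coord v x) / norm_sq v) *\<^sub>R J0 (hperp v)
    + Re (z3 x) *\<^sub>R e5 + Im (z3 x) *\<^sub>R J0 e5"
  using norm_sq_pos[OF assms]
  by (intro adapted_eqI[OF assms]) (simp_all add: adapted_hvec adapted_hperp adapted_e5 complex_eq_iff)

lemma bracket_J0: "bracket (J0 x) y = J0 (bracket x y)"
  by (simp add: z_eq_iff algebra_simps)

locale orthogonal_structure =
  fixes J :: "real^6^6"
  assumes orthogonal: "orthogonal_matrix J" and square: "J ** J = - mat 1"
begin

lemma J_linear: "J *v (x + y) = J *v x + J *v y" "J *v (r *\<^sub>R x) = r *\<^sub>R (J *v x)"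
  by (simp_all add: matrix_vector_right_distrib linear_scale[OF matrix_vector_mul_linear])

lemma JJ: "J *v (J *v x) = - x"
  using square by (rule square_minus_one_apply)

lemma isometry: "(J *v x) \<bullet> (J *v y) = x \<bullet> y"
proof -
  have "orthogonal_transformation (\<lambda>x. J *v x)"
    by (simp add: orthogonal_transformation_matrix orthogonal)
  then show ?thesis by (simp add: orthogonal_transformation_def)
qed

lemma skew: "(J *v x) \<bullet> y = - (x \<bullet> (J *v y))"
  using isometry[of "J *v x" y] by (simp add: JJ)

lemma skew_self: "(J *v x) \<bullet> x = 0"
  using skew[of x x] by (simp add: inner_commute)

text \<open>
  If \<open>J x\<close> is proportional to \<open>J0 x\<close> then, \<open>J\<close> being an isometry of square \<open>- 1\<close>, it agrees with
  \<open>\<plusminus> J0\<close> on the whole complex line of \<open>x\<close>.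
\<close>

lemma eigenline_sign:
  assumes "x \<noteq> 0" "J *v x = r *\<^sub>R J0 x"
  shows "is_sign r" "J *v J0 x = r *\<^sub>R J0 (J0 x)"
proof -
  have "r * r * (x \<bullet> x) = x \<bullet> x"
    using isometry[of x x] by (simp add: assms(2))
  then have r: "r * r = 1" using assms(1) by simp
  then show "is_sign r" by (simp add: is_sign_def square_eq_1_iff)
  have "J0 x = r *\<^sub>R (J *v x)" by (simp add: assms(2) r)
  then have "J *v J0 x = J *v (r *\<^sub>R (J *v x))" by (rule arg_cong)
  then show "J *v J0 x = r *\<^sub>R J0 (J0 x)" by (simp add: J_linear JJ)
qed

lemma eq_split_J:
  assumes v: "v \<noteq> 0" and a: "J *v hvec v = (e$1) *\<^sub>R J0 (hvec v)"
    and b: "J *v hperp v = (e$2) *\<^sub>R J0 (hperp v)" and c: "J *v e5 = (e$3) *\<^sub>R J0 e5"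
  shows "J = split_J_matrix e v" "\<And>k. is_sign (e$k)"
proof -
  have nz: "hvec v \<noteq> 0" "hperp v \<noteq> 0" "e5 \<noteq> 0"
    using v by (auto simp: z_eq_iff vec_eq_iff forall_2 hperp_def)
  note A = eigenline_sign[OF nz(1) a] and B = eigenline_sign[OF nz(2) b] and C = eigenline_sign[OF nz(3) c]
  have "J *v x = split_J e v x" for x
  proof (rule adapted_eqI[OF v])
    have *: "J *v x = (Re (line_coord v x) / norm_sq v) *\<^sub>R (J *v hvec v) + (Im (line_coord v x) / norm_sq v) *\<^sub>R (J *v J0 (hvec v))
    + (Re (perp_coord v x) / norm_sq v) *\<^sub>R (J *v hperp v) + (Im (perp_coord v x) / norm_sq v) *\<^sub>R (J *v J0 (hperp v))
    + Re (z3 x) *\<^sub>R (J *v e5) + Im (z3 x) *\<^sub>R (J *v J0 e5)"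
      by (subst adapted_expansion[OF v, of x]) (simp only: J_linear)
    show "line_coord v (J *v x) = line_coord v (split_J e v x)" "perp_coord v (J *v x) = perp_coord v (split_J e v x)"
       "z3 (J *v x) = z3 (split_J e v x)"
      unfolding * a b c A(2) B(2) C(2) split_J_adapted[OF v] using norm_sq_pos[OF v]
      by (simp_all add: adapted_hvec adapted_hperp adapted_e5 complex_eq_iff)
  qed
  then show "J = split_J_matrix e v" by (simp add: matrix_eq split_J_matrix_apply[OF v])
  show "is_sign (e$k)" for k
    using A(1) B(1) C(1) exhaust_3[of k] by auto
qed

text \<open>
  The algebraic heart of the condition on \<open>J\<close>. The Nijenhuis tensor on \<open>v\<close> and \<open>e\<^sub>5\<close> says that
  \<open>c = [v, J e\<^sub>5]\<close> satisfies \<open>J c = r J0 c\<close>. If \<open>c\<close> were nonzero, \<open>J\<close> would preserve the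
  vertical plane, \<open>J e\<^sub>5\<close> would be central and \<open>c\<close> would vanish after all. So \<open>J e\<^sub>5\<close> commutes with
  \<open>v\<close> and is orthogonal to \<open>v\<close> and \<open>J0 v\<close>, which makes it vertical; by skewness \<open>J\<close> then also
  preserves the remaining line.
\<close>

lemma integrable_eq_split_J:
  assumes v: "v \<noteq> 0" and a: "J *v hvec v = r *\<^sub>R J0 (hvec v)" and nijenhuis_alg: "\<And>x y. nijenhuis_alg J x y = 0"
  shows "\<exists>e. J = split_J_matrix e v \<and> (\<forall>k. is_sign (e$k))"
proof -
  note A = eigenline_sign[OF hvec_nonzero[OF v] a]
  define c where "c = bracket (hvec v) (J *v e5)"
  have "J *v c = r *\<^sub>R J0 c"
    using nijenhuis_alg[of "hvec v" e5] by (simp add: nijenhuis_alg_def a bracket_bilinear bracket_J0 bracket_vertical c_def)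
  have "c = 0"
  proof (rule ccontr)
    assume "c \<noteq> 0"
    then have z: "z1 c = 0" "z2 c = 0" "z3 c \<noteq> 0" by (auto simp: c_def z_eq_iff)
    have "e5 = Re (1 / z3 c) *\<^sub>R c + Im (1 / z3 c) *\<^sub>R J0 c"
    proof (rule z_eqI)
      have "complex_of_real (Re (1 / z3 c)) * z3 c + complex_of_real (Im (1 / z3 c)) * (\<i> * z3 c)
          = (1 / z3 c) * z3 c"
        by (subst (3) complex_eq) (simp add: algebra_simps)
      then show "z3 e5 = z3 (Re (1 / z3 c) *\<^sub>R c + Im (1 / z3 c) *\<^sub>R J0 c)" using z(3) by simp
    qed (use z in simp_all)
    then have "J *v e5 = Re (1 / z3 c) *\<^sub>R (J *v c) + Im (1 / z3 c) *\<^sub>R (J *v J0 c)"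
      by (metis J_linear)
    also have "\<dots> = Re (1 / z3 c) *\<^sub>R r *\<^sub>R J0 c + Im (1 / z3 c) *\<^sub>R r *\<^sub>R J0 (J0 c)"
      using eigenline_sign(2)[OF \<open>c \<noteq> 0\<close> \<open>J *v c = r *\<^sub>R J0 c\<close>] \<open>J *v c = r *\<^sub>R J0 c\<close> by simp
    finally have "z1 (J *v e5) = 0" "z2 (J *v e5) = 0" by (simp_all add: z)
    then have "c = 0" by (simp add: c_def bracket_vertical)
    with \<open>c \<noteq> 0\<close> show False by simp
  qed
  then have "perp_coord v (J *v e5) = 0"
    by (simp add: c_def z_eq_iff perp_coord_def)
  moreover have "Re (line_coord v (J *v e5)) = 0" "Im (line_coord v (J *v e5)) = 0"
    unfolding inner_hvec[symmetric] skew a A(2) by (simp_all add: inner_z)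
  moreover have "Re (z3 (J *v e5)) = 0"
    using skew_self[of e5] by (simp add: inner_e5)
  ultimately have "J *v e5 = Im (z3 (J *v e5)) *\<^sub>R J0 e5"
    by (intro adapted_eqI[OF v]) (simp_all add: adapted_e5 complex_eq_iff)
  then obtain r3 where c: "J *v e5 = r3 *\<^sub>R J0 e5" by blast
  have "e5 \<noteq> 0" by (simp add: z_eq_iff)
  note C = eigenline_sign[OF this c]
  have "Re (z3 (J *v hperp v)) = 0" "Im (z3 (J *v hperp v)) = 0"
    unfolding inner_e5[symmetric] skew c C(2) by (simp_all add: inner_z adapted_hperp)
  moreover have "Re (line_coord v (J *v hperp v)) = 0" "Im (line_coord v (J *v hperp v)) = 0"
    unfolding inner_hvec[symmetric] skew a A(2) by (simp_all add: inner_hvec adapted_hperp)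
  moreover have "Re (perp_coord v (J *v hperp v)) = 0"
    using skew_self[of "hperp v"] by (simp add: inner_hperp)
  ultimately have "J *v hperp v = (Im (perp_coord v (J *v hperp v)) / norm_sq v) *\<^sub>R J0 (hperp v)"
    using norm_sq_pos[OF v]
    by (intro adapted_eqI[OF v]) (simp_all add: adapted_hperp complex_eq_iff)
  then obtain r2 where b: "J *v hperp v = r2 *\<^sub>R J0 (hperp v)" by blast
  define e :: "real^3" where "e = vector [r, r2, r3]"
  have "J = split_J_matrix e v" "\<And>k. is_sign (e$k)"
    using eq_split_J[OF v, of e] a b c by (simp_all add: e_def)
  then show ?thesis by blast
qed

end

text \<open>
  The plane lies in the complex line of any of its vectors \<open>p\<close>. It equals that line because
  \<open>J p\<close> lies in it and is orthogonal to \<open>p\<close>, hence is a multiple of \<open>J0 p\<close>.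
\<close>

lemma mixed_W34_V5_standard:
  assumes "m \<in> mixed_W34_V5"
  shows "\<exists>i v. v \<noteq> 0 \<and> m = standard_mixed (signs i) v"
proof -
  obtain J W Or where m: "m = (J, W, Or)" by (cases m)
  have ocs: "J \<in> OCS_pos" and plane: "(W, Or) \<in> oriented_planes" and inv: "\<And>x. x \<in> W \<Longrightarrow> J *v x \<in> W"
    and pos: "\<And>x. x \<in> W \<Longrightarrow> x \<noteq> 0 \<Longrightarrow> (x, J *v x) \<in> Or" and w34: "class_W34 J"
    and ops: "OPS_class {5} (W, Or)"
    using assms by (auto simp: m mixed_W34_V5_def mixed_structures_def)
  interpret orthogonal_structure J
    using ocs by unfold_locales (auto simp: OCS_pos_def)
  have nijenhuis_alg: "nijenhuis_alg J x y = 0" for x y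
    using w34 class_W34_iff[OF square] by blast
  obtain p q where W: "W = span {p, q}" and Or: "Or = positive_bases p q" and "independent {p, q}"
    using plane unfolding oriented_planes_def by blast
  then have p: "p \<in> W" "p \<noteq> 0"
    using dependent_zero[of "{p, q}"] by (auto simp: span_base)
  note hor = OPS_class5_abelian_horizontal[OF W ops]
  have sub: "subspace W" by (simp add: W)
  define v :: "complex^2" where "v = vector [z1 p, z2 p]"
  have hv: "hvec v = p" using hor(2)[OF p(1)] by (simp add: z_eq_iff v_def)
  then have v: "v \<noteq> 0" using p(2) by (auto simp: z_eq_iff)
  have le: "x \<in> hline v" if "x \<in> W" for x
    unfolding mem_hline[OF v]
    using hor(1)[OF p(1) that] hor(2)[OF that] by (simp add: z_eq_iff perp_coord_def v_def)
  obtain s r where sr: "J *v p = s *\<^sub>R p + r *\<^sub>R J0 p"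
    using le[OF inv[OF p(1)]] by (auto simp: mem_hline_combination hv)
  have "s * (p \<bullet> p) = 0"
    using skew_self[of p] by (simp add: sr inner_add_left)
  then have Jp: "J *v p = r *\<^sub>R J0 p" using p(2) by (simp add: sr)
  have "J0 p = r *\<^sub>R (J *v p)"
    using is_sign_square(2)[OF eigenline_sign(1)[OF p(2) Jp]] by (simp add: Jp)
  then have "J0 p \<in> W" using subspace_scale[OF sub inv[OF p(1)]] by simp
  then have "hline v \<subseteq> W"
    unfolding hline_span hv using p(1) sub by (intro span_minimal) auto
  with le have Wv: "W = hline v" by blast
  obtain e where e: "J = split_J_matrix e v" "\<And>k. is_sign (e$k)"
    using integrable_eq_split_J[OF v _ nijenhuis_alg, of r] Jp by (auto simp: hv)
  have "e$1 * e$2 * e$3 = 1"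
    using ocs split_J_OCS_pos[OF v e(2)] e(1) by simp
  moreover have "z3 (bracket (hvec v) (hperp v)) \<noteq> 0"
    using norm_sq_pos[OF v] by (simp add: z3_bracket_adapted[OF v] adapted_hvec adapted_hperp del: z_ops(6))
  then have "e$3 * (e$1 + e$2) - e$1 * e$2 - 1 = 0"
    using nijenhuis_alg_split_J(1)[OF v, of e "hvec v" "hperp v"] nijenhuis_alg unfolding e(1)
    by (simp del: z_ops(6) of_real_diff of_real_mult of_real_add)
  ultimately obtain i where "e = signs i" using signs_iff[OF e(2)] by blast
  with e(1) have J: "J = split_J_matrix (signs i) v" by simp
  have "Or = positive_bases p (J *v p)"
    using positive_bases_eqI[of p "J *v p" p q] pos[OF p] by (simp add: Or)
  with J have "m = standard_mixed (signs i) v"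
    by (simp only: m standard_mixed_def hv Wv)
  with v show ?thesis by blast
qed

section \<open>The 2-forms and the three projective lines\<close>

text \<open>
  The form of a structure takes the value \<open>(1 + \<alpha>) e$1\<close> on the line and \<open>e$2\<close> on its horizontal
  complement; this is the difference.
\<close>

definition line_coeff :: "real \<Rightarrow> real^3 \<Rightarrow> real" where "line_coeff \<alpha> e = (1 + \<alpha>) * e$1 - e$2"

definition Jbase :: "real^3 \<Rightarrow> real^6 \<Rightarrow> real^6" where
  "Jbase e x = cvec (\<i> * of_real (e$2) * z1 x) (\<i> * of_real (e$2) * z2 x) (\<i> * of_real (e$3) * z3 x)"

definition base_form :: "real^3 \<Rightarrow> real^6^6" where
  "base_form e = (\<chi> i j. Jbase e (axis i 1) $ j)"

lemma norm_sq_inner: "hvec v \<bullet> hvec v = norm_sq v"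
  by (simp add: inner_hvec adapted_hvec)

lemma split_J_eq:
  assumes "v \<noteq> 0"
  shows "split_J e v x = ((e$1 - e$2) / norm_sq v) *\<^sub>R
     ((x \<bullet> hvec v) *\<^sub>R J0 (hvec v) - (x \<bullet> J0 (hvec v)) *\<^sub>R hvec v) + Jbase e x"
proof (rule adapted_eqI[OF assms])
  have b: "line_coord v (Jbase e x) = \<i> * of_real (e$2) * line_coord v x" "perp_coord v (Jbase e x) = \<i> * of_real (e$2) * perp_coord v x"
    by (simp_all add: Jbase_def line_coord_def perp_coord_def algebra_simps)
  show "line_coord v (split_J e v x) = line_coord v (((e$1 - e$2) / norm_sq v) *\<^sub>R
     ((x \<bullet> hvec v) *\<^sub>R J0 (hvec v) - (x \<bullet> J0 (hvec v)) *\<^sub>R hvec v) + Jbase e x)"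
    using norm_sq_pos[OF assms]
    by (simp add: split_J_adapted[OF assms] b adapted_hvec inner_hvec complex_eq_iff field_simps)
  show "perp_coord v (split_J e v x) = perp_coord v (((e$1 - e$2) / norm_sq v) *\<^sub>R
     ((x \<bullet> hvec v) *\<^sub>R J0 (hvec v) - (x \<bullet> J0 (hvec v)) *\<^sub>R hvec v) + Jbase e x)"
    by (simp add: split_J_adapted[OF assms] b adapted_hvec)
qed (simp add: split_J_adapted[OF assms] Jbase_def)

lemma fundamental_form_split_J:
  assumes "v \<noteq> 0"
  shows "fundamental_form (split_J_matrix e v)
    = ((e$1 - e$2) / norm_sq v) *\<^sub>R wedge (hvec v) (J0 (hvec v)) + base_form e"
  by (simp add: vec_eq_iff fundamental_form_def split_J_matrix_apply[OF assms] split_J_eq[OF assms] inner_axis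
      inner_axis' wedge_def base_form_def algebra_simps)

lemma wedge_rotate: "wedge (s *\<^sub>R x + t *\<^sub>R y) (s *\<^sub>R y - t *\<^sub>R x) = (s\<^sup>2 + t\<^sup>2) *\<^sub>R wedge x y"
  by (simp add: vec_eq_iff wedge_def power2_eq_square algebra_simps)

text \<open>
  Shows that the unit vector chosen in \<open>mixed_form\<close> does not matter.
\<close>

lemma wedge_unit_vector:
  assumes "v \<noteq> 0" "w \<in> hline v" "norm w = 1"
  shows "wedge w (split_J_matrix e v *v w) = (e$1 / norm_sq v) *\<^sub>R wedge (hvec v) (J0 (hvec v))"
proof -
  obtain s t where w: "w = s *\<^sub>R hvec v + t *\<^sub>R J0 (hvec v)"
    using assms(2) unfolding mem_hline_combination by blast
  have Jw: "J0 w = s *\<^sub>R J0 (hvec v) - t *\<^sub>R hvec v"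
    by (simp add: w J0_linear)
  have "w \<bullet> w = (s\<^sup>2 + t\<^sup>2) * norm_sq v"
    by (simp add: w inner_add_left inner_add_right norm_sq_inner power2_eq_square algebra_simps)
  then have "(s\<^sup>2 + t\<^sup>2) * norm_sq v = 1"
    using assms(3) by (simp add: dot_square_norm)
  then have st: "s\<^sup>2 + t\<^sup>2 = 1 / norm_sq v"
    using norm_sq_pos[OF assms(1)] by (simp add: field_simps)
  have "wedge w (split_J_matrix e v *v w) = (e$1) *\<^sub>R wedge w (J0 w)"
    unfolding split_J_hline[OF assms(1,2)] by (simp add: vec_eq_iff wedge_def algebra_simps)
  also have "wedge w (J0 w) = (1 / norm_sq v) *\<^sub>R wedge (hvec v) (J0 (hvec v))"
    unfolding Jw unfolding w wedge_rotate st ..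
  finally show ?thesis by simp
qed

lemma mixed_form_standard:
  assumes "v \<noteq> 0"
  shows "mixed_form \<alpha> (standard_mixed e v)
    = (line_coeff \<alpha> e / norm_sq v) *\<^sub>R wedge (hvec v) (J0 (hvec v)) + base_form e"
proof -
  define w where "w = (SOME w. w \<in> hline v \<and> norm w = 1)"
  have "sgn (hvec v) \<in> hline v"
    unfolding sgn_div_norm mem_hline_combination by (rule exI[of _ "inverse (norm (hvec v))"], rule exI[of _ 0]) simp
  moreover have "norm (sgn (hvec v)) = 1" using hvec_nonzero[OF assms] by (simp add: norm_sgn)
  ultimately have "w \<in> hline v \<and> norm w = 1"
    unfolding w_def by (rule someI[where P = "\<lambda>w. w \<in> hline v \<and> norm w = 1", OF conjI])
  then have "wedge w (split_J_matrix e v *v w) = (e$1 / norm_sq v) *\<^sub>R wedge (hvec v) (J0 (hvec v))"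
    using wedge_unit_vector[OF assms] by blast
  moreover have "mixed_form \<alpha> (standard_mixed e v)
      = fundamental_form (split_J_matrix e v) + \<alpha> *\<^sub>R wedge w (split_J_matrix e v *v w)"
    by (simp add: mixed_form_def standard_mixed_def w_def Let_def)
  ultimately show ?thesis
    by (simp add: fundamental_form_split_J[OF assms] line_coeff_def vec_eq_iff field_simps
        add_divide_distrib diff_divide_distrib)
qed

lemma mixed_form_entries:
  assumes "v \<noteq> 0" "\<omega> = mixed_form \<alpha> (standard_mixed e v)"
  shows "\<omega>$1$2 = e$2 + line_coeff \<alpha> e * (cmod (v$1))\<^sup>2 / norm_sq v"
    "\<omega>$3$4 = e$2 + line_coeff \<alpha> e * (cmod (v$2))\<^sup>2 / norm_sq v"
    "\<omega>$5$6 = e$3"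
    "\<omega>$1$3 = line_coeff \<alpha> e * Im (v$1 * cnj (v$2)) / norm_sq v"
    "\<omega>$1$4 = line_coeff \<alpha> e * Re (v$1 * cnj (v$2)) / norm_sq v"
proof -
  have J: "Jbase e x = vector [- (e$2) * x$2, e$2 * x$1, - (e$2) * x$4, e$2 * x$3, - (e$3) * x$6, e$3 * x$5]" for x
    by (simp add: Jbase_def cvec_def z1_def z2_def z3_def)
  have u: "hvec v = vector [Re (v$1), Im (v$1), Re (v$2), Im (v$2), 0, 0]"
    by (simp add: hvec_def cvec_def)
  show "\<omega>$1$2 = e$2 + line_coeff \<alpha> e * (cmod (v$1))\<^sup>2 / norm_sq v"
    "\<omega>$3$4 = e$2 + line_coeff \<alpha> e * (cmod (v$2))\<^sup>2 / norm_sq v"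
    "\<omega>$5$6 = e$3"
    "\<omega>$1$3 = line_coeff \<alpha> e * Im (v$1 * cnj (v$2)) / norm_sq v"
    "\<omega>$1$4 = line_coeff \<alpha> e * Re (v$1 * cnj (v$2)) / norm_sq v"
    unfolding assms(2) mixed_form_standard[OF assms(1)] cmod_power2
    by (simp_all add: base_form_def J wedge_def u power2_eq_square) (simp_all add: axis_def)
qed

lemma complex_line_eqD:
  assumes "complex_line v = complex_line w"
  shows "\<exists>c. w = c *s v"
proof -
  have "1 *s w \<in> complex_line w" unfolding complex_line_def by blast
  then show ?thesis using assms by (auto simp: complex_line_def)
qed

lemma complex_line_scale:
  assumes "c \<noteq> 0" shows "complex_line (c *s v) = complex_line v"
proof -
  have "d *s v = (d / c) *s (c *s v)" for d using assms by simp
  then have "complex_line v \<subseteq> complex_line (c *s v)" unfolding complex_line_def by blast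
  moreover have "complex_line (c *s v) \<subseteq> complex_line v" by (auto simp: complex_line_def)
  ultimately show ?thesis by blast
qed

lemma split_J_scale:
  assumes "v \<noteq> 0" "c \<noteq> 0"
  shows "split_J_matrix e (c *s v) = split_J_matrix e v"
proof -
  have nz: "c *s v \<noteq> 0" using assms by simp
  have s: "line_coord (c *s v) x = cnj c * line_coord v x" "perp_coord (c *s v) x = c * perp_coord v x" for x
    by (simp_all add: line_coord_def perp_coord_def algebra_simps)
  have "split_J e (c *s v) x = split_J e v x" for x
    using split_J_adapted[OF nz, of e x] assms(2)
    by (intro adapted_eqI[OF assms(1)]) (simp_all add: s split_J_adapted[OF assms(1)])
  then have "split_J e (c *s v) = split_J e v" by (rule ext)
  then show ?thesis by (simp only: split_J_matrix_def)
qed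

lemma standard_mixed_scale:
  assumes "v \<noteq> 0" "c \<noteq> 0" "is_sign (e$1)"
  shows "standard_mixed e (c *s v) = standard_mixed e v"
proof -
  have u: "hvec (c *s v) = Re c *\<^sub>R hvec v + Im c *\<^sub>R J0 (hvec v)"
    by (simp add: z_eq_iff complex_eq_iff)
  have h: "hline (c *s v) = hline v" by (simp add: hline_def complex_line_scale[OF assms(2)])
  have "hvec (c *s v) \<in> hline v" unfolding u mem_hline_combination by blast
  note J = split_J_hline[OF assms(1) this]
  have "Re c \<noteq> 0 \<or> Im c \<noteq> 0" using assms(2) by (simp add: complex_eq_iff)
  from positive_bases_rotate[OF this split_J_hvec[OF assms(1)] assms(3)]
  have "(hvec (c *s v), split_J_matrix e v *v hvec (c *s v)) \<in> positive_bases (hvec v) (split_J_matrix e v *v hvec v)"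
    unfolding J unfolding u .
  from positive_bases_eqI[OF this] show ?thesis
    by (simp add: standard_mixed_def split_J_scale[OF assms(1,2)] h)
qed

text \<open>
  Lines are given as sets, so a spanning vector is chosen; by \<open>standard_mixed_scale\<close> the result depends
  only on the line.
\<close>

definition three_families :: "3 \<times> (complex^2) set \<Rightarrow> mixed" where
  "three_families = (\<lambda>(i, L). standard_mixed (signs i) (SOME v. v \<noteq> 0 \<and> complex_line v = L))"

lemma three_families_line:
  assumes "v \<noteq> 0"
  shows "three_families (i, complex_line v) = standard_mixed (signs i) v"
proof -
  define w where "w = (SOME w. w \<noteq> 0 \<and> complex_line w = complex_line v)"
  have w: "w \<noteq> 0 \<and> complex_line w = complex_line v"
    unfolding w_def using assms by (intro someI[where P = "\<lambda>w. w \<noteq> 0 \<and> complex_line w = complex_line v"]) simp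
  then obtain c where c: "w = c *s v" using complex_line_eqD[of v w] by auto
  with w have "c \<noteq> 0" by auto
  from standard_mixed_scale[OF assms this is_sign_signs] show ?thesis
    by (simp add: three_families_def c flip: w_def)
qed

lemma inj_hvec: "inj hvec"
  by (rule injI) (auto simp: z_eq_iff vec_eq_iff forall_2)

lemma bij_betw_three_families: "bij_betw three_families three_CP1 mixed_W34_V5"
  unfolding bij_betw_def
proof
  show "inj_on three_families three_CP1"
  proof (rule inj_onI, clarsimp simp: three_CP1_def CP1_def)
    fix i j v w
    assume v: "v \<noteq> 0" and w: "w \<noteq> 0"
      and eq: "three_families (i, complex_line v) = three_families (j, complex_line w)"
    then have "hline v = hline w" by (simp add: three_families_line standard_mixed_def)
    then have L: "complex_line v = complex_line w"
      unfolding hline_def by (simp add: inj_image_eq_iff[OF inj_hvec])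
    have "standard_mixed (signs i) v = standard_mixed (signs j) v"
      using eq unfolding L[symmetric] three_families_line[OF v] .
    then have "split_J_matrix (signs i) v = split_J_matrix (signs j) v" by (simp add: standard_mixed_def)
    then have J: "split_J (signs i) v x = split_J (signs j) v x" for x
      using split_J_matrix_apply[OF v, of "signs i" x] split_J_matrix_apply[OF v, of "signs j" x] by simp
    have "signs i $ 1 = signs j $ 1" "signs i $ 3 = signs j $ 3"
      using split_J_adapted(1)[OF v, of "signs i" "hvec v"] split_J_adapted(1)[OF v, of "signs j" "hvec v"]
        split_J_adapted(3)[OF v, of "signs i" e5] split_J_adapted(3)[OF v, of "signs j" e5] norm_sq_pos[OF v]
      unfolding J by (simp_all add: adapted_hvec)
    then have "i = j"
      using exhaust_3[of i] exhaust_3[of j] by (auto simp: signs_def)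
    with L show "i = j \<and> complex_line v = complex_line w" by simp
  qed
  show "three_families ` three_CP1 = mixed_W34_V5"
  proof
    show "three_families ` three_CP1 \<subseteq> mixed_W34_V5"
      by (auto simp: three_CP1_def CP1_def three_families_line standard_mixed_class)
    show "mixed_W34_V5 \<subseteq> three_families ` three_CP1"
    proof
      fix m assume "m \<in> mixed_W34_V5"
      then obtain i v where "v \<noteq> 0" "m = three_families (i, complex_line v)"
        using mixed_W34_V5_standard three_families_line by metis
      then show "m \<in> three_families ` three_CP1" unfolding three_CP1_def CP1_def by blast
    qed
  qed
qed

lemma bounded_bilinear_wedge: "bounded_bilinear wedge"
  unfolding bilinear_conv_bounded_bilinear[symmetric] bilinear_def
  by (auto intro!: linearI simp: wedge_def vec_eq_iff algebra_simps)

text \<open>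
  The form is a rational expression in the spanning vector with denominator \<open>|v|\<^sup>2\<close>.
\<close>

lemma smooth_on_mixed_form:
  assumes "open S" "smooth_on S (\<lambda>z. hvec (v z))" "\<And>z. z \<in> S \<Longrightarrow> v z \<noteq> 0"
  shows "smooth_on S (\<lambda>z. mixed_form \<alpha> (standard_mixed e (v z)))"
proof -
  let ?u = "\<lambda>z. hvec (v z)"
  have J: "bounded_linear J0"
    unfolding linear_conv_bounded_linear[symmetric] by (rule linearI) (simp_all add: J0_linear)
  have n: "smooth_on S (\<lambda>z. line_coeff \<alpha> e *\<^sub>R inverse (?u z \<bullet> ?u z))"
    using assms(3) hvec_nonzero
    by (intro smooth_on_linear[OF bounded_linear_scaleR_right assms(1)] smooth_on_inverse assms(1)
      smooth_on_bilinear[OF bounded_bilinear_inner assms(1)] assms(2)) auto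
  have "smooth_on S (\<lambda>z. (line_coeff \<alpha> e *\<^sub>R inverse (?u z \<bullet> ?u z)) *\<^sub>R wedge (?u z) (J0 (?u z)) + base_form e)"
    by (intro smooth_on_add smooth_on_bilinear[OF bounded_bilinear_scaleR assms(1)] n smooth_on_const assms(1)
       smooth_on_bilinear[OF bounded_bilinear_wedge assms(1)] smooth_on_linear[OF J assms(1)] assms(2))
  moreover have "mixed_form \<alpha> (standard_mixed e (v z))
      = (line_coeff \<alpha> e *\<^sub>R inverse (?u z \<bullet> ?u z)) *\<^sub>R wedge (?u z) (J0 (?u z)) + base_form e" if "z \<in> S" for z
    using mixed_form_standard[OF assms(3)[OF that]] by (simp add: norm_sq_inner divide_inverse)
  ultimately show ?thesis
    using Ck_on_cong[OF assms(1)] unfolding smooth_on_def by (metis (no_types, lifting))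
qed

lemma affine_charts_nonzero: "vector [1, z] \<noteq> (0 :: complex^2)" "vector [z, 1] \<noteq> (0 :: complex^2)"
  by (simp_all add: vec_eq_iff forall_2)

lemma smooth_on_affine_charts:
  "smooth_on UNIV (\<lambda>z. hvec (vector [1, z]))" "smooth_on UNIV (\<lambda>z. hvec (vector [z, 1]))"
proof -
  have L: "bounded_linear (\<lambda>z. cvec 0 z 0)" "bounded_linear (\<lambda>z. cvec z 0 0)"
    unfolding linear_conv_bounded_linear[symmetric]
    by (rule linearI; simp add: z_eq_iff scaleR_conv_of_real[where 'a=complex])+
  have "smooth_on UNIV (\<lambda>z. cvec 1 0 0 + cvec 0 z 0)" "smooth_on UNIV (\<lambda>z. cvec 0 1 0 + cvec z 0 0)"
    by (intro smooth_on_add smooth_on_const open_UNIV smooth_on_linear[OF L(1)] smooth_on_linear[OF L(2)] smooth_on_ident)+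
  moreover have "cvec 1 0 0 + cvec 0 z 0 = hvec (vector [1, z])" "cvec 0 1 0 + cvec z 0 0 = hvec (vector [z, 1])" for z
    by (simp_all add: z_eq_iff)
  ultimately show "smooth_on UNIV (\<lambda>z. hvec (vector [1, z]))" "smooth_on UNIV (\<lambda>z. hvec (vector [z, 1]))"
    by simp_all
qed

lemma smooth_three_families_chart:
  assumes "\<phi> \<in> three_CP1_params"
  shows "smooth_on UNIV (\<lambda>z. mixed_form \<alpha> (three_families (\<phi> z)))"
proof -
  from assms obtain i where "\<phi> = (\<lambda>z. (i, complex_line (vector [1, z]))) \<or> \<phi> = (\<lambda>z. (i, complex_line (vector [z, 1])))"
    by (auto simp: three_CP1_params_def CP1_params_def)
  then show ?thesis
    using smooth_on_mixed_form[OF open_UNIV smooth_on_affine_charts(1)]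
      smooth_on_mixed_form[OF open_UNIV smooth_on_affine_charts(2)]
    by (auto simp: three_families_line affine_charts_nonzero)
qed

text \<open>
  The \<open>e\<^sup>5\<^sup>6\<close> coefficient is the third sign, and the sum of the other two is
  \<open>e$2 + (1 + \<alpha>) e$1\<close>, which equals \<open>\<alpha>\<close> and \<open>- \<alpha>\<close> in the second and third family. These open sets
  therefore separate the families.
\<close>

definition component_nbhd :: "3 \<Rightarrow> (real^6^6) set" where
  "component_nbhd i = {\<omega>. if i = 1 then \<omega>$5$6 > 0
     else \<omega>$5$6 < 0 \<and> (if i = 2 then \<omega>$1$2 + \<omega>$3$4 > 0 else \<omega>$1$2 + \<omega>$3$4 < 0)}"

lemma open_component_nbhd: "open (component_nbhd i)"
proof -
  have "component_nbhd i = (if i = 1 then {\<omega>. 0 < \<omega>$5$6}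
     else {\<omega>. \<omega>$5$6 < 0} \<inter> (if i = 2 then {\<omega>. 0 < \<omega>$1$2 + \<omega>$3$4} else {\<omega>. \<omega>$1$2 + \<omega>$3$4 < 0}))"
    by (auto simp: component_nbhd_def)
  then show ?thesis
    by (auto intro!: open_Int open_Collect_less continuous_intros)
qed

lemma norm_sq_shares:
  assumes "v \<noteq> 0"
  shows "(cmod (v$1))\<^sup>2 / norm_sq v + (cmod (v$2))\<^sup>2 / norm_sq v = 1"
  unfolding add_divide_distrib[symmetric] norm_sq_def[symmetric] using norm_sq_pos[OF assms] by simp

lemma mixed_form_component:
  assumes "\<alpha> > 0" "v \<noteq> 0"
  shows "mixed_form \<alpha> (standard_mixed (signs j) v) \<in> component_nbhd i \<longleftrightarrow> i = j"
proof -
  let ?\<omega> = "mixed_form \<alpha> (standard_mixed (signs j) v)" and ?e = "signs j"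
  note E = mixed_form_entries[OF assms(2) refl, of \<alpha> ?e]
  have "?\<omega>$1$2 + ?\<omega>$3$4
      = 2 * ?e$2 + line_coeff \<alpha> ?e * ((cmod (v$1))\<^sup>2 / norm_sq v + (cmod (v$2))\<^sup>2 / norm_sq v)"
    unfolding E by (simp add: algebra_simps)
  then have tr: "?\<omega>$1$2 + ?\<omega>$3$4 = ?e$2 + (1 + \<alpha>) * ?e$1"
    by (simp add: norm_sq_shares[OF assms(2)] line_coeff_def)
  show ?thesis
    unfolding component_nbhd_def mem_Collect_eq tr E(3)
    using assms(1) exhaust_3[of i] exhaust_3[of j] by (auto simp: signs_def)
qed

lemma line_coeff_nonzero: "\<alpha> > 0 \<Longrightarrow> line_coeff \<alpha> (signs i) \<noteq> 0"
  using exhaust_3[of i] by (auto simp: line_coeff_def signs_def)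

text \<open>
  For \<open>v\<^sub>1 \<noteq> 0\<close> the coefficient of \<open>e\<^sup>1\<^sup>2\<close> minus \<open>e$2\<close> is proportional to \<open>v\<^sub>1 cnj v\<^sub>1\<close> and those of
  \<open>e\<^sup>1\<^sup>4\<close> and \<open>e\<^sup>1\<^sup>3\<close> are, with the same factor, the real and imaginary part of \<open>v\<^sub>1 cnj v\<^sub>2\<close>. Dividing the
  conjugate of the latter by the former gives the affine coordinate \<open>v\<^sub>2 / v\<^sub>1\<close>. The other chart needs
  no conjugation; both are treated at once, with \<open>k\<close> the index of the coordinate that does not
  vanish and the sign \<open>s\<close> for the conjugation.
\<close>

lemma smooth_local_inverse:
  assumes "m \<in> mixed_W34_V5" "\<alpha> > 0"
  shows "\<exists>U h. \<exists>\<phi>\<in>three_CP1_params. open U \<and> mixed_form \<alpha> m \<in> U \<and> smooth_on U h \<and>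
    (\<forall>m'\<in>mixed_W34_V5. mixed_form \<alpha> m' \<in> U \<longrightarrow> m' = three_families (\<phi> (h (mixed_form \<alpha> m'))))"
proof -
  obtain i v where v: "v \<noteq> 0" and m: "m = standard_mixed (signs i) v"
    using mixed_W34_V5_standard[OF assms(1)] by blast
  let ?e = "signs i"
  have lin: "bounded_linear (\<lambda>\<omega>::real^6^6. Complex (\<omega>$a$b) (s * \<omega>$c$d))" for a b c d s
    unfolding linear_conv_bounded_linear[symmetric]
    by (rule linearI) (simp_all add: complex_eq_iff algebra_simps)
  have nth: "bounded_linear (\<lambda>\<omega>::real^6^6. \<omega>$a$b)" for a b
    unfolding linear_conv_bounded_linear[symmetric] by (rule linearI) simp_all
  have chart: ?thesis
    if a: "\<And>w. w \<noteq> 0 \<Longrightarrow> mixed_form \<alpha> (standard_mixed ?e w) $ a $ a' = ?e$2 + line_coeff \<alpha> ?e * (cmod (w$k))\<^sup>2 / norm_sq w"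
      and b: "\<And>w. w \<noteq> 0 \<Longrightarrow> Complex (mixed_form \<alpha> (standard_mixed ?e w) $ 1 $ 4) (s * mixed_form \<alpha> (standard_mixed ?e w) $ 1 $ 3)
          = of_real (line_coeff \<alpha> ?e / norm_sq w) * (w$k' * cnj (w$k))"
      and \<phi>: "(\<lambda>z. (i, complex_line (\<phi> z))) \<in> three_CP1_params" "\<And>w. w$k \<noteq> 0 \<Longrightarrow> w = w$k *s \<phi> (w$k' / w$k)" "\<And>z. \<phi> z \<noteq> 0"
      and k: "v$k \<noteq> 0"
    for a a' s k k' \<phi>
  proof -
    define U where "U = component_nbhd i \<inter> {\<omega>. \<omega>$a$a' \<noteq> ?e$2}"
    define h where "h \<omega> = inverse (\<omega>$a$a' + - ?e$2) *\<^sub>R Complex (\<omega>$1$4) (s * \<omega>$1$3)" for \<omega> :: "real^6^6"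
    have "open U"
      unfolding U_def by (intro open_Int open_component_nbhd open_Collect_neq continuous_intros)
    moreover have "mixed_form \<alpha> m \<in> U"
      using v k line_coeff_nonzero[OF assms(2), of i] norm_sq_pos[OF v]
      by (simp add: U_def m mixed_form_component[OF assms(2) v] a)
    moreover have "smooth_on U h"
      unfolding h_def
      by (intro smooth_on_bilinear[OF bounded_bilinear_scaleR \<open>open U\<close>] smooth_on_inverse \<open>open U\<close>
         smooth_on_add smooth_on_const smooth_on_linear[OF nth] smooth_on_linear[OF lin] smooth_on_ident)
        (auto simp: U_def)
    moreover have "m' = three_families (i, complex_line (\<phi> (h (mixed_form \<alpha> m'))))"
      if m': "m' \<in> mixed_W34_V5" "mixed_form \<alpha> m' \<in> U" for m'
    proof -
      obtain j w where w: "w \<noteq> 0" and j: "m' = standard_mixed (signs j) w"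
        using mixed_W34_V5_standard[OF m'(1)] by blast
      with m'(2) have "i = j" by (simp add: U_def mixed_form_component[OF assms(2)])
      then have w': "m' = standard_mixed ?e w" using j by simp
      have wk: "w$k \<noteq> 0" using m'(2) a[OF w] by (auto simp: U_def w')
      have "h (mixed_form \<alpha> m') = inverse (line_coeff \<alpha> ?e * (cmod (w$k))\<^sup>2 / norm_sq w) *\<^sub>R
          (of_real (line_coeff \<alpha> ?e / norm_sq w) * (w$k' * cnj (w$k)))"
        unfolding h_def w' a[OF w] b[OF w] by simp
      also have "\<dots> = w$k' * cnj (w$k) / of_real ((cmod (w$k))\<^sup>2)"
        using line_coeff_nonzero[OF assms(2), of i] norm_sq_pos[OF w] wk
        by (simp add: scaleR_conv_of_real field_simps)
      also have "\<dots> = w$k' / w$k"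
        using wk by (simp add: complex_norm_square field_simps del: of_real_power)
      finally have h: "h (mixed_form \<alpha> m') = w$k' / w$k" .
      have "m' = standard_mixed ?e (w$k *s \<phi> (w$k' / w$k))"
        using \<phi>(2)[OF wk] w' by simp
      also have "\<dots> = three_families (i, complex_line (\<phi> (h (mixed_form \<alpha> m'))))"
        using standard_mixed_scale[OF \<phi>(3) wk is_sign_signs] by (simp add: three_families_line[OF \<phi>(3)] h)
      finally show ?thesis .
    qed
    ultimately show ?thesis using \<phi>(1) by (intro exI[of _ U] exI[of _ h] bexI[of _ "\<lambda>z. (i, complex_line (\<phi> z))"]) auto
  qed
  have params: "(\<lambda>z. (i, complex_line (vector [1, z]))) \<in> three_CP1_params"
    "(\<lambda>z. (i, complex_line (vector [z, 1]))) \<in> three_CP1_params"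
    by (auto simp: three_CP1_params_def CP1_params_def)
  have off_diagonal:
    "Complex (mixed_form \<alpha> (standard_mixed ?e w) $ 1 $ 4) (- 1 * mixed_form \<alpha> (standard_mixed ?e w) $ 1 $ 3)
      = of_real (line_coeff \<alpha> ?e / norm_sq w) * (w$2 * cnj (w$1))"
    "Complex (mixed_form \<alpha> (standard_mixed ?e w) $ 1 $ 4) (1 * mixed_form \<alpha> (standard_mixed ?e w) $ 1 $ 3)
      = of_real (line_coeff \<alpha> ?e / norm_sq w) * (w$1 * cnj (w$2))" if "w \<noteq> 0" for w
    unfolding mixed_form_entries[OF that refl]
    by (simp_all add: complex_eq_iff algebra_simps diff_divide_distrib add_divide_distrib)
  have rescale: "w$1 \<noteq> 0 \<Longrightarrow> w = w$1 *s vector [1, w$2 / w$1]"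
    "w$2 \<noteq> 0 \<Longrightarrow> w = w$2 *s vector [w$1 / w$2, 1]" for w :: "complex^2"
    by (simp_all add: vec_eq_iff forall_2)
  have "v$1 \<noteq> 0 \<or> v$2 \<noteq> 0" using v by (auto simp: vec_eq_iff forall_2)
  then show ?thesis
  proof
    assume "v$1 \<noteq> 0"
    from chart[OF mixed_form_entries(1)[OF _ refl] off_diagonal(1) params(1) rescale(1)
        affine_charts_nonzero(1) this] show ?thesis .
  next
    assume "v$2 \<noteq> 0"
    from chart[OF mixed_form_entries(2)[OF _ refl] off_diagonal(2) params(2) rescale(2)
        affine_charts_nonzero(2) this] show ?thesis .
  qed
qed

lemma diffeomorphism_three_families:
  assumes "\<alpha> > 0"
  shows "diffeomorphism_onto_subset three_CP1_params three_CP1 (mixed_form \<alpha>) mixed_W34_V5 three_families"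
  unfolding diffeomorphism_onto_subset_def
  using bij_betw_three_families smooth_three_families_chart smooth_local_inverse[OF _ assms] by blast

section \<open>The image of the moment map\<close>

text \<open>
  The segment is parametrized by \<open>|v\<^sub>2|\<^sup>2 / |v|\<^sup>2\<close>.
\<close>

lemma moment_map_component:
  "(\<lambda>v. moment_map (mixed_form \<alpha> (standard_mixed e v))) ` {v. v \<noteq> 0}
    = closed_segment (vector [(1 + \<alpha>) * e$1, e$2, e$3]) (vector [e$2, (1 + \<alpha>) * e$1, e$3])"
proof -
  let ?P = "vector [(1 + \<alpha>) * e$1, e$2, e$3] :: real^3" and ?Q = "vector [e$2, (1 + \<alpha>) * e$1, e$3] :: real^3"
  have mu: "moment_map (mixed_form \<alpha> (standard_mixed e v))
      = (1 - (cmod (v$2))\<^sup>2 / norm_sq v) *\<^sub>R ?P + ((cmod (v$2))\<^sup>2 / norm_sq v) *\<^sub>R ?Q" if v: "v \<noteq> 0" for v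
  proof -
    have "(cmod (v$1))\<^sup>2 / norm_sq v = 1 - (cmod (v$2))\<^sup>2 / norm_sq v"
      using norm_sq_shares[OF v] by simp
    then show ?thesis
      by (simp add: moment_map_def mixed_form_entries[OF v refl] line_coeff_def vec_eq_iff forall_3
          times_divide_eq_right[symmetric] del: times_divide_eq_right) (simp add: algebra_simps)
  qed
  show ?thesis
  proof (intro set_eqI iffI)
    fix y assume "y \<in> (\<lambda>v. moment_map (mixed_form \<alpha> (standard_mixed e v))) ` {v. v \<noteq> 0}"
    then obtain v where v: "v \<noteq> 0" and y: "y = moment_map (mixed_form \<alpha> (standard_mixed e v))" by blast
    have "0 \<le> (cmod (v$2))\<^sup>2 / norm_sq v" "(cmod (v$2))\<^sup>2 / norm_sq v \<le> 1"
      using norm_sq_pos[OF v] by (simp_all add: norm_sq_def)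
    then show "y \<in> closed_segment ?P ?Q" unfolding y mu[OF v] closed_segment_def by blast
  next
    fix y assume "y \<in> closed_segment ?P ?Q"
    then obtain t where t: "0 \<le> t" "t \<le> 1" and y: "y = (1 - t) *\<^sub>R ?P + t *\<^sub>R ?Q"
      unfolding closed_segment_def by blast
    define v :: "complex^2" where "v = vector [of_real (sqrt (1 - t)), of_real (sqrt t)]"
    have n: "norm_sq v = 1" "(cmod (v$2))\<^sup>2 = t" using t by (simp_all add: norm_sq_def v_def)
    then have "v \<noteq> 0" by (auto simp: norm_sq_def)
    moreover have "y = moment_map (mixed_form \<alpha> (standard_mixed e v))"
      by (simp add: mu[OF \<open>v \<noteq> 0\<close>] n y)
    ultimately show "y \<in> (\<lambda>v. moment_map (mixed_form \<alpha> (standard_mixed e v))) ` {v. v \<noteq> 0}" by blast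
  qed
qed

theorem corollary34:
  fixes \<alpha> :: real
  assumes "\<alpha> > 0"
  shows "(\<exists>f. diffeomorphism_onto_subset three_CP1_params three_CP1
              (mixed_form \<alpha>) mixed_W34_V5 f) \<and>
         (\<lambda>m. moment_map (mixed_form \<alpha> m)) ` mixed_W34_V5 =
           closed_segment (vector [1 + \<alpha>, 1, 1]) (vector [1, 1 + \<alpha>, 1]) \<union>
           closed_segment (vector [1 + \<alpha>, - 1, - 1]) (vector [- 1, 1 + \<alpha>, - 1]) \<union>
           closed_segment (vector [1, - 1 - \<alpha>, - 1]) (vector [- 1 - \<alpha>, 1, - 1])"
proof
  show "\<exists>f. diffeomorphism_onto_subset three_CP1_params three_CP1 (mixed_form \<alpha>) mixed_W34_V5 f"
    using diffeomorphism_three_families[OF assms] by blast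
  have families: "mixed_W34_V5 = (\<Union>i. standard_mixed (signs i) ` {v. v \<noteq> 0})"
    using mixed_W34_V5_standard standard_mixed_class by blast
  have "(\<lambda>m. moment_map (mixed_form \<alpha> m)) ` mixed_W34_V5
      = (\<Union>i. (\<lambda>v. moment_map (mixed_form \<alpha> (standard_mixed (signs i) v))) ` {v. v \<noteq> 0})"
    unfolding families image_UN image_image by (rule refl)
  also have "\<dots> = closed_segment (vector [1 + \<alpha>, 1, 1]) (vector [1, 1 + \<alpha>, 1]) \<union>
           closed_segment (vector [1 + \<alpha>, - 1, - 1]) (vector [- 1, 1 + \<alpha>, - 1]) \<union>
           closed_segment (vector [- 1 - \<alpha>, 1, - 1]) (vector [1, - 1 - \<alpha>, - 1])"
    unfolding moment_map_component UNIV_3 by (simp add: signs_def Un_assoc)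
  finally show "(\<lambda>m. moment_map (mixed_form \<alpha> m)) ` mixed_W34_V5 =
           closed_segment (vector [1 + \<alpha>, 1, 1]) (vector [1, 1 + \<alpha>, 1]) \<union>
           closed_segment (vector [1 + \<alpha>, - 1, - 1]) (vector [- 1, 1 + \<alpha>, - 1]) \<union>
           closed_segment (vector [1, - 1 - \<alpha>, - 1]) (vector [- 1 - \<alpha>, 1, - 1])"
    by (simp only: closed_segment_commute[of "vector [- 1 - \<alpha>, 1, - 1]"])
qed

end
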